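(* Let $\Omega=[a,b]\times[c,d]$, degrees $k,l>0$, knots $\Delta\lambda,\Delta\mu$, orders $u\in\{0,\dots,k-1\}$, $v\in\{0,\dots,l-1\}$, a parameter $\alpha\in(0,1)$, points $(x_i,y_j)\in\Omega$ and values $f_{ij}\in\mathbb{R}$ ($i=1,\dots,n$, $j=1,\dots,m$) be given. The tensor smoothing spline $s_{kl}\in\mathcal{S}_{kl}^{\Delta\lambda,\Delta\mu}(\Omega)$ which minimizes $$J_{uv}(s_{kl})=\alpha\sum_{i=1}^{n}\sum_{j=1}^{m}\left[f_{ij}-s_{kl}(x_i,y_j)\right]^2+(1-\alpha)\iint_\Omega\left[\frac{\partial^{u}}{\partial x^{u}}\frac{\partial^{v}}{\partial y^{v}}s_{kl}(x,y)\right]^2dx\,dy$$ among all splines in $\mathcal{S}_{kl}^{\Delta\lambda,\Delta\mu}(\Omega)$ satisfying $\iint_\Omega s_{kl}(x,y)\,dx\,dy=0$ is obtained as $$s_{kl}(x,y)=\mathbb{B}(x,y)\,\mathbb{D}\,\widetilde{\mathbb{K}}\,cs(\widetilde{\mathbf{C}^*}),$$ where $$cs(\widetilde{\mathbf{C}^*})=\left[\widetilde{\mathbb{K}}^{\top}\mathbb{D}^{\top}\left[(1-\alpha)\,\mathbb{S}^{\top}\mathbb{M}\,\mathbb{S}+\alpha\,\mathbb{B}^{\top}\mathbb{B}\right]\mathbb{D}\,\widetilde{\mathbb{K}}\right]^{+}\alpha\,\widetilde{\mathbb{K}}^{\top}\mathbb{D}^{\top}\mathbb{B}^{\top}\,cs(\mathbf{F}),\qquad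 \mathbf{F}=(f_{ij})\in\mathbb{R}^{n\times m}.$$ That is, this spline belongs to $\mathcal{S}_{kl}^{\Delta\lambda,\Delta\mu}(\Omega)$, has zero integral over $\Omega$, and attains the minimum of $J_{uv}$ over the zero-integral splines in $\mathcal{S}_{kl}^{\Delta\lambda,\Delta\mu}(\Omega)$.
   Context: Knots: $\Delta\lambda$: $\lambda_0=a<\lambda_1<\dots<\lambda_g<b=\lambda_{g+1}$; $\Delta\mu$: $\mu_0=c<\mu_1<\dots<\mu_h<d=\mu_{h+1}$; extended by coincident additional knots $\lambda_{-k}=\dots=\lambda_{-1}=a$, $\lambda_{g+2}=\dots=\lambda_{g+k+1}=b$, $\mu_{-l}=\dots=\mu_{-1}=c$, $\mu_{h+2}=\dots=\mu_{h+l+1}=d$. $B_i^{k+1}(x)$ ($i=-k,\dots,g$) denotes the normalized B-spline (partition of unity) of degree $k$ (order $k+1$) on the knots $\lambda_i,\dots,\lambda_{i+k+1}$; similarly $B_j^{l+1}(y)$ ($j=-l,\dots,h$) on $\mu_j,\dots,\mu_{j+l+1}$. As usual, B-splines are taken left-continuous at the right endpoint of the interval. $\mathcal{S}_{kl}^{\Delta\lambda,\Delta\mu}(\Omega)$ is the space of tensor product splines $\sum_{i=-k}^{g}\sum_{j=-l}^{h}b_{ij}B_i^{k+1}(x)B_j^{l+1}(y)$, $b_{ij}\in\mathbb{R}$. $cs(\cdot)$ is columnwise vectorization, $\otimes$ is the Kronecker product, $A^+$ is the Moore–Penrose pseudoinverse. $\mathbf{B}_{k+1}(x)=(B_{-k}^{k+1}(x),\dots,B_g^{k+1}(x))$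 and $\mathbf{B}_{l+1}(y)=(B_{-l}^{l+1}(y),\dots,B_h^{l+1}(y))$ are row vectors; $\mathbb{B}(x,y)=\mathbf{B}_{l+1}(y)\otimes\mathbf{B}_{k+1}(x)$, so that $s_{kl}(x,y)=\mathbb{B}(x,y)\,cs(\mathbf{B})$ with $\mathbf{B}=(b_{ij})$. The matrix $\mathbb{B}$ without arguments is $\mathbb{B}=\mathbf{B}_{l+1}(\mathbf{y})\otimes\mathbf{B}_{k+1}(\mathbf{x})$, where $\mathbf{B}_{k+1}(\mathbf{x})$ is the $n\times(g+k+1)$ matrix with rows $\mathbf{B}_{k+1}(x_i)$ and $\mathbf{B}_{l+1}(\mathbf{y})$ is the $m\times(h+l+1)$ matrix with rows $\mathbf{B}_{l+1}(y_j)$. Derivative matrices: $\mathbf{S}_u=\mathbf{D}_u^x\mathbf{L}_u^x\cdots\mathbf{D}_1^x\mathbf{L}_1^x\in\mathbb{R}^{(g+k+1-u)\times(g+k+1)}$ (identity if $u=0$), with $\mathbf{D}_j^x=(k+1-j)\,\mathrm{diag}\left(\frac{1}{\lambda_{i+k+1-j}-\lambda_i}\right)_{i=-k+j}^{g}$ and $\mathbf{L}_j^x\in\mathbb{R}^{(g+k+1-j)\times(g+k+2-j)}$ the bidiagonal first-difference matrix with $-1$ on the main diagonal and $1$ on the superdiagonal. Analogously $\mathbf{S}_v=\mathbf{D}_v^y\mathbf{L}_v^y\cdots\mathbf{D}_1^y\mathbf{L}_1^y\in\mathbb{R}^{(h+l+1-v)\times(h+l+1)}$, with $\mathbf{D}_j^y=(l+1-j)\,\mathrm{diag}\left(\frac{1}{\mu_{i+l+1-j}-\mu_i}\right)_{i=-l+j}^{h}$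 and $\mathbf{L}_j^y\in\mathbb{R}^{(h+l+1-j)\times(h+l+2-j)}$ the first-difference matrix. $\mathbb{S}=\mathbf{S}_v\otimes\mathbf{S}_u$. Gram matrices: $\mathbf{M}_{k,u}^x=\left(\int_a^b B_i^{k+1-u}(x)B_j^{k+1-u}(x)\,dx\right)_{i,j=-k+u}^{g}$, $\mathbf{M}_{l,v}^y=\left(\int_c^d B_i^{l+1-v}(y)B_j^{l+1-v}(y)\,dy\right)_{i,j=-l+v}^{h}$, where $B_i^{k+1-u}$ (degree $k-u$) and $B_i^{l+1-v}$ (degree $l-v$) are the B-splines on the same knot sequences; $\mathbb{M}=\mathbf{M}_{l,v}^y\otimes\mathbf{M}_{k,u}^x$. Constraint matrices: $\mathbf{D}_x=(k+1)\,\mathrm{diag}\left(\frac{1}{\lambda_{i+k+1}-\lambda_i}\right)_{i=-k}^{g}$, $\mathbf{D}_y=(l+1)\,\mathrm{diag}\left(\frac{1}{\mu_{j+l+1}-\mu_j}\right)_{j=-l}^{h}$, $\mathbb{D}=\mathbf{D}_y\otimes\mathbf{D}_x$. $\mathbf{K}_x\in\mathbb{R}^{(g+k+1)\times(g+k+2)}$ and $\mathbf{K}_y\in\mathbb{R}^{(h+l+1)\times(h+l+2)}$ are first-difference matrices ($-1$ on the diagonal, $1$ on the superdiagonal), $\mathbb{K}=\mathbf{K}_y\otimes\mathbf{K}_x$. It acts on $cs(\mathbf{C})$, $\mathbf{C}=(c_{ij})_{i=-k-1,\dots,g;\;j=-l-1,\dots,h}$. Write $cs(\widetilde{\mathbf{C}})$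 for $cs(\mathbf{C})$ with its first entry $c_{-k-1,-l-1}$ removed. $\widetilde{\mathbb{K}}$ is the matrix such that $\mathbb{K}\,cs(\mathbf{C})=\widetilde{\mathbb{K}}\,cs(\widetilde{\mathbf{C}})$ for every $\mathbf{C}$ satisfying $c_{-k-1,-l-1}=c_{-k-1,h}+c_{g,-l-1}-c_{g,h}$; that is, $\widetilde{\mathbb{K}}$ is obtained from $\mathbb{K}$ by deleting its first column, after adding that column to the columns corresponding to $c_{-k-1,h}$ and $c_{g,-l-1}$ and subtracting it from the column corresponding to $c_{g,h}$. *)

theory Defs
  imports "HOL-Analysis.Analysis" "Jordan_Normal_Form.Matrix"
begin

no_notation vec_nth (infixl "$" 90)

text \<open>A knot sequence is a function on the integers; only its values at the indices
  \<open>-k, \<dots>, g + k + 1\<close> matter.\<close>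

definition extended_knots :: "nat \<Rightarrow> nat \<Rightarrow> real \<Rightarrow> real \<Rightarrow> (int \<Rightarrow> real) \<Rightarrow> bool" where
  "extended_knots k g a b t \<longleftrightarrow>
     t 0 = a \<and> t (int g + 1) = b \<and> strict_mono_on {0..int g + 1} t \<and>
     (\<forall>i\<in>{- int k..-1}. t i = a) \<and>
     (\<forall>i\<in>{int g + 2..int g + int k + 1}. t i = b)"

text \<open>\<open>bspline t g p i\<close> is the normalized B-spline of degree \<open>p\<close> (order \<open>p + 1\<close>) on the knots
  \<open>t i, \<dots>, t (i + p + 1)\<close>, given by the Cox--de Boor recursion. The usual convention that a
  quotient with denominator zero is replaced by zero agrees with division by zero in HOL.
  The last nonempty knot interval, which ends in \<open>t (g + 1)\<close>, is closed on the right, so that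
  all B-splines are left-continuous at the right endpoint.\<close>

fun bspline :: "(int \<Rightarrow> real) \<Rightarrow> nat \<Rightarrow> nat \<Rightarrow> int \<Rightarrow> real \<Rightarrow> real" where
  "bspline t g 0 i x =
     (if t i \<le> x \<and> x < t (i + 1) \<or> t i < t (i + 1) \<and> t (i + 1) = t (int g + 1) \<and> x = t (int g + 1)
      then 1 else 0)"
| "bspline t g (Suc p) i x =
     (x - t i) / (t (i + int p + 1) - t i) * bspline t g p i x
     + (t (i + int p + 2) - x) / (t (i + int p + 2) - t (i + 1)) * bspline t g p (i + 1) x"

text \<open>B-splines vanish outside the interval spanned by their knots, so a spline regarded as a
  function on the plane is determined by its restriction to the rectangle.\<close>

definition tensor_splines ::
  "nat \<Rightarrow> nat \<Rightarrow> (int \<Rightarrow> real) \<Rightarrow> nat \<Rightarrow> nat \<Rightarrow> (int \<Rightarrow> real) \<Rightarrow> (real \<Rightarrow> real \<Rightarrow> real) set" where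
  "tensor_splines k g lam l h mu =
     {s. \<exists>\<beta> :: int \<Rightarrow> int \<Rightarrow> real. s = (\<lambda>x y. \<Sum>i = - int k..int g. \<Sum>j = - int l..int h.
           \<beta> i j * bspline lam g k i x * bspline mu h l j y)}"

text \<open>Derivatives are taken within the given interval, i.e. they are one-sided at its
  endpoints.\<close>

primrec iterated_deriv :: "real set \<Rightarrow> nat \<Rightarrow> (real \<Rightarrow> real) \<Rightarrow> real \<Rightarrow> real" where
  "iterated_deriv S 0 f = f"
| "iterated_deriv S (Suc r) f = (\<lambda>x. vector_derivative (iterated_deriv S r f) (at x within S))"

definition mixed_deriv ::
  "real set \<Rightarrow> real set \<Rightarrow> nat \<Rightarrow> nat \<Rightarrow> (real \<Rightarrow> real \<Rightarrow> real) \<Rightarrow> real \<Rightarrow> real \<Rightarrow> real" where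
  "mixed_deriv X Y u v s x y =
     iterated_deriv X u (\<lambda>x'. iterated_deriv Y v (\<lambda>y'. s x' y') y) x"

definition smoothing_functional ::
  "real \<Rightarrow> real \<Rightarrow> real \<Rightarrow> real \<Rightarrow> nat \<Rightarrow> nat \<Rightarrow> real \<Rightarrow> real vec \<Rightarrow> real vec \<Rightarrow> real mat \<Rightarrow>
   (real \<Rightarrow> real \<Rightarrow> real) \<Rightarrow> real" where
  "smoothing_functional a b c d u v \<alpha> xs ys F s =
     \<alpha> * (\<Sum>i<dim_vec xs. \<Sum>j<dim_vec ys. (F $$ (i, j) - s (xs $ i) (ys $ j))\<^sup>2)
     + (1 - \<alpha>) * integral ({a..b} \<times> {c..d})
         (\<lambda>(x, y). (mixed_deriv {a..b} {c..d} u v s x y)\<^sup>2)"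

definition kron :: "real mat \<Rightarrow> real mat \<Rightarrow> real mat" (infixl "\<otimes>\<^sub>m" 75) where
  "A \<otimes>\<^sub>m B = mat (dim_row A * dim_row B) (dim_col A * dim_col B)
     (\<lambda>(i, j). A $$ (i div dim_row B, j div dim_col B) * B $$ (i mod dim_row B, j mod dim_col B))"

definition cs :: "real mat \<Rightarrow> real vec" where
  "cs C = vec (dim_row C * dim_col C) (\<lambda>p. C $$ (p mod dim_row C, p div dim_row C))"

definition is_pseudoinverse :: "real mat \<Rightarrow> real mat \<Rightarrow> bool" where
  "is_pseudoinverse A X \<longleftrightarrow>
     X \<in> carrier_mat (dim_col A) (dim_row A) \<and>
     A * X * A = A \<and> X * A * X = X \<and> (A * X)\<^sup>T = A * X \<and> (X * A)\<^sup>T = X * A"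

definition pseudoinverse :: "real mat \<Rightarrow> real mat" where
  "pseudoinverse A = (THE X. is_pseudoinverse A X)"

text \<open>In all matrices below, row and column indices start at \<open>0\<close>, so that the B-spline with
  index \<open>i \<in> {-k..g}\<close> occupies position \<open>i + k\<close>.\<close>

text \<open>The matrix with rows \<open>B\<^bsub>k+1\<^esub>(x\<^sub>i)\<close>; the row vector \<open>B\<^bsub>k+1\<^esub>(x)\<close> itself is the case of a
  single point.\<close>

definition bspline_mat :: "(int \<Rightarrow> real) \<Rightarrow> nat \<Rightarrow> nat \<Rightarrow> real vec \<Rightarrow> real mat" where
  "bspline_mat t g k xs = mat (dim_vec xs) (g + k + 1)
     (\<lambda>(r, i). bspline t g k (int i - int k) (xs $ r))"

definition bspline_row :: "(int \<Rightarrow> real) \<Rightarrow> nat \<Rightarrow> nat \<Rightarrow> real \<Rightarrow> real mat" where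
  "bspline_row t g k x = bspline_mat t g k (vec 1 (\<lambda>_. x))"

text \<open>\<open>knot_diag t g k j\<close> is
  \<open>(k + 1 - j) diag (1 / (t (i + k + 1 - j) - t i))\<close> for \<open>i = -k + j, \<dots>, g\<close>. For \<open>j \<ge> 1\<close> this is
  the factor \<open>D\<^sub>j\<close> of the derivative matrix, for \<open>j = 0\<close> it is the matrix used in the
  zero-integral constraint.\<close>

definition knot_diag :: "(int \<Rightarrow> real) \<Rightarrow> nat \<Rightarrow> nat \<Rightarrow> nat \<Rightarrow> real mat" where
  "knot_diag t g k j = real (k + 1 - j) \<cdot>\<^sub>m mat_diag (g + k + 1 - j)
     (\<lambda>r. let i = int r - int k + int j in 1 / (t (i + int k + 1 - int j) - t i))"

definition diff_mat :: "nat \<Rightarrow> real mat" where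
  "diff_mat N = mat N (N + 1) (\<lambda>(i, j). if j = i then -1 else if j = i + 1 then 1 else 0)"

primrec deriv_mat :: "(int \<Rightarrow> real) \<Rightarrow> nat \<Rightarrow> nat \<Rightarrow> nat \<Rightarrow> real mat" where
  "deriv_mat t g k 0 = 1\<^sub>m (g + k + 1)"
| "deriv_mat t g k (Suc u) =
     knot_diag t g k (Suc u) * diff_mat (g + k + 1 - Suc u) * deriv_mat t g k u"

definition gram_mat :: "(int \<Rightarrow> real) \<Rightarrow> nat \<Rightarrow> nat \<Rightarrow> nat \<Rightarrow> real mat" where
  "gram_mat t g k u = mat (g + k + 1 - u) (g + k + 1 - u)
     (\<lambda>(r, q). integral {t 0..t (int g + 1)}
        (\<lambda>x. bspline t g (k - u) (int r - int k + int u) x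
             * bspline t g (k - u) (int q - int k + int u) x))"

text \<open>\<open>reduce_constraint p q K\<close> incorporates the constraint
  \<open>C\<^sub>0\<^sub>,\<^sub>0 = C\<^sub>0\<^sub>,\<^sub>q\<^sub>-\<^sub>1 + C\<^sub>p\<^sub>-\<^sub>1\<^sub>,\<^sub>0 - C\<^sub>p\<^sub>-\<^sub>1\<^sub>,\<^sub>q\<^sub>-\<^sub>1\<close> on a \<open>p \<times> q\<close> matrix \<open>C\<close> into a matrix \<open>K\<close> acting on
  \<open>cs C\<close>: the first column is added to those belonging to \<open>C\<^sub>0\<^sub>,\<^sub>q\<^sub>-\<^sub>1\<close> (position \<open>(q - 1) p\<close>) and
  \<open>C\<^sub>p\<^sub>-\<^sub>1\<^sub>,\<^sub>0\<close> (position \<open>p - 1\<close>), subtracted from that of \<open>C\<^sub>p\<^sub>-\<^sub>1\<^sub>,\<^sub>q\<^sub>-\<^sub>1\<close> (position \<open>p q - 1\<close>), and then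
  deleted, so that column \<open>j\<close> of the result comes from column \<open>j + 1\<close> of \<open>K\<close>.\<close>

definition reduce_constraint :: "nat \<Rightarrow> nat \<Rightarrow> real mat \<Rightarrow> real mat" where
  "reduce_constraint p q K = mat (dim_row K) (dim_col K - 1)
     (\<lambda>(i, j). K $$ (i, j + 1) +
        (if j + 1 = (q - 1) * p \<or> j + 1 = p - 1 then K $$ (i, 0)
         else if j + 1 = p * q - 1 then - K $$ (i, 0)
         else 0))"

end

theory Submission
  imports Defs "Jordan_Normal_Form.Gauss_Jordan_Elimination"
begin

text \<open>
  A spline of the tensor product space is determined by its coefficient vector \<open>e\<close>, and
  \<open>J(s\<^sub>e) = \<alpha> |cs F - B e|\<^sup>2 + (1 - \<alpha>) (S e)\<^sup>T M (S e)\<close>, because differentiation acts on B-spline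
  coefficients by scaled differences and \<open>M\<close> is the Gram matrix of the lower order B-splines.
  Since the integral of a B-spline is its support length divided by its order, writing
  \<open>e = D w\<close> turns the integral of \<open>s\<^sub>e\<close> into the sum of the entries of \<open>w\<close>; and the vectors with
  entry sum 0 are exactly the mixed second differences of the grids \<open>C\<close> that satisfy the corner
  constraint. So the admissible coefficients form the range of \<open>R = D K\<close> (with the reduced \<open>K\<close>),
  and on it the problem is an unconstrained convex quadratic one. Its normal equations \<open>A z = r\<close> are
  solvable, because the kernel of the positive semidefinite matrix \<open>A\<close> lies in that of \<open>B R\<close> and
  is therefore orthogonal to \<open>r\<close>, and so \<open>A\<^sup>+ r\<close> is a solution.
\<close>

text \<open>The grid \<open>C\<close> comes from antidifferentiation: it holds the coefficients of a
  spline of bidegree (k+1, l+1) whose mixed first derivative is s, so D and K are the usual scaled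
  differences of B-spline derivatives. On clamped knots the corner coefficients are corner values,
  and the corner constraint says that this antiderivative has zero mixed increment over the
  rectangle. The parametrization is redundant, since mixed differences ignore grids of the form p(i)
  + q(j). With N = g+k+1 and M = h+l+1, the reduced K has NM + N + M columns but rank NM - 1, so the
  matrix of the normal equations is singular for all data and an ordinary inverse never exists. Two
  features of splines shape the analytic part. The bounds u < k and v < l keep the degree at least 1
  after differentiation, so the derivatives exist on the whole closed rectangle and are continuous.
  And a knot sequence is prescribed only on a finite window of indices, whereas induction on the
  degree shifts the index; B-splines are therefore studied on knots extended constantly to all
  integers, and the results are carried back.\<close>

section \<open>The Moore--Penrose pseudoinverse and regularized least squares\<close>

no_notation inner (infix "\<bullet>" 70)

text \<open>The premises compare dimensions instead of naming carriers. They contain no variable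
  that the left-hand side does not fix, so simp can reassociate whole products.\<close>

lemma mult_mat_assoc_dim:
  fixes A B C :: "'a :: semiring_0 mat"
  shows "dim_col A = dim_row B \<Longrightarrow> dim_col B = dim_row C \<Longrightarrow> A * B * C = A * (B * C)"
  by (rule assoc_mult_mat[of A _ "dim_row B" B "dim_row C"]) auto

lemma transpose_mult_dim:
  fixes A B :: "'a :: comm_semiring_0 mat"
  shows "dim_col A = dim_row B \<Longrightarrow> (A * B)\<^sup>T = B\<^sup>T * A\<^sup>T"
  by (rule transpose_mult[of A _ "dim_row B"]) auto

lemma index_mult_mat_sum:
  fixes A B :: "'a :: comm_semiring_0 mat"
  assumes "A \<in> carrier_mat nr n" "B \<in> carrier_mat n nc" "i < nr" "j < nc"
  shows "(A * B) $$ (i, j) = (\<Sum>k<n. A $$ (i, k) * B $$ (k, j))"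
  using assms by (auto simp: scalar_prod_def atLeast0LessThan intro!: sum.cong)

text \<open>In the reduced row echelon form \<open>C = P * A\<close> the pivot columns are unit
  vectors. Ones at the positions \<open>(f i, i)\<close> give a matrix \<open>E\<close> for which
  \<open>C * E\<close> is the projection onto the nonzero rows, so \<open>C * E * C = C\<close>.
  Undoing the row operations yields a generalized inverse of \<open>A\<close>.\<close>

lemma generalized_inverse_exists:
  fixes A :: "'a :: field mat"
  assumes A: "A \<in> carrier_mat nr nc"
  obtains G where "G \<in> carrier_mat nc nr" "A * G * A = A"
proof -
  define C where "C = gauss_jordan_single A"
  note gj = gauss_jordan_single[OF A C_def[symmetric]]
  have C: "C \<in> carrier_mat nr nc" by (rule gj(2))
  obtain P Q where PQ: "C = P * A" "P \<in> carrier_mat nr nr" "Q \<in> carrier_mat nr nr"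
    "P * Q = 1\<^sub>m nr" "Q * P = 1\<^sub>m nr" using gj(4) by blast
  obtain f where piv: "pivot_fun C f nc"
    using gj(3) C unfolding row_echelon_form_def by auto
  note f = pivot_funD[OF carrier_matD(1)[OF C] piv]
  \<comment> \<open>A zero row of \<open>C\<close> has \<open>f i = nc\<close>, which no row index
    of \<open>E\<close> attains, so the corresponding column of \<open>E\<close> is zero.\<close>
  define E :: "'a mat" where "E = mat nc nr (\<lambda>(j, i). if f i = j then 1 else 0)"
  have E: "E \<in> carrier_mat nc nr" by (simp add: E_def)
  have CE: "(C * E) $$ (r, i) = (if r = i \<and> f i < nc then 1 else 0)" if "r < nr" "i < nr" for r i
  proof -
    have "(C * E) $$ (r, i) = (\<Sum>j<nc. C $$ (r, j) * E $$ (j, i))"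
      by (rule index_mult_mat_sum[OF C E that])
    also have "\<dots> = (\<Sum>j<nc. if j = f i then C $$ (r, j) else 0)"
      using that by (intro sum.cong) (auto simp: E_def)
    also have "\<dots> = (if f i < nc then C $$ (r, f i) else 0)"
      by (simp add: sum.delta)
    finally show ?thesis using f that by auto
  qed
  have CEC: "C * E * C = C"
  proof (rule eq_matI)
    fix r j assume "r < dim_row C" "j < dim_col C"
    then have r: "r < nr" and j: "j < nc" using C by auto
    have "(C * E * C) $$ (r, j) = (\<Sum>i<nr. (C * E) $$ (r, i) * C $$ (i, j))"
      by (rule index_mult_mat_sum[OF mult_carrier_mat[OF C E] C r j])
    also have "\<dots> = (\<Sum>i<nr. if i = r then (if f r < nc then C $$ (r, j) else 0) else 0)"
      using r by (intro sum.cong) (auto simp: CE simp del: index_mult_mat)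
    also have "\<dots> = (if f r < nc then C $$ (r, j) else 0)" using r by simp
    also have "\<dots> = C $$ (r, j)" using f(1,2)[of r] r j by force
    finally show "(C * E * C) $$ (r, j) = C $$ (r, j)" .
  qed (use C E in auto)
  show thesis
  proof
    show "E * P \<in> carrier_mat nc nr" using E PQ by auto
    have "Q * C = (Q * P) * A" unfolding PQ(1) using PQ(2,3) A by (simp add: mult_mat_assoc_dim)
    then have AQ: "Q * C = A" using A by (simp only: PQ(5) left_mult_one_mat)
    have "Q * C * (E * P) * A = Q * (C * E * (P * A))"
      using PQ(2,3) A C E by (simp add: mult_mat_assoc_dim)
    also have "\<dots> = Q * (C * E * C)" by (simp only: PQ(1)[symmetric])
    also have "\<dots> = A" by (simp only: CEC AQ)
    finally have "Q * C * (E * P) * A = A" .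
    then show "A * (E * P) * A = A" by (simp only: AQ)
  qed
qed

lemma gram_eq_0_imp_eq_0:
  fixes A :: "real mat"
  assumes "A \<in> carrier_mat nr nc" "A\<^sup>T * A = 0\<^sub>m nc nc"
  shows "A = 0\<^sub>m nr nc"
proof (rule eq_matI)
  fix i j assume ij: "i < dim_row (0\<^sub>m nr nc :: real mat)" "j < dim_col (0\<^sub>m nr nc :: real mat)"
  have "(\<Sum>k = 0..<nr. (A $$ (k, j))\<^sup>2) = (A\<^sup>T * A) $$ (j, j)"
    using assms(1) ij by (auto simp: scalar_prod_def power2_eq_square intro!: sum.cong)
  also have "\<dots> = 0" using assms ij by simp
  finally have "\<forall>k\<in>{0..<nr}. (A $$ (k, j))\<^sup>2 = 0"
    by (subst (asm) sum_nonneg_eq_0_iff) auto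
  then show "A $$ (i, j) = 0\<^sub>m nr nc $$ (i, j)" using ij by auto
qed (use assms in auto)

text \<open>With a symmetric generalized inverse \<open>G\<close> of the Gram matrix,
  \<open>L = G * A\<^sup>T\<close> makes \<open>A * L\<close> symmetric. The columns of the defect
  \<open>A * L * A - A\<close> lie in the range of \<open>A\<close> and are annihilated by
  \<open>A\<^sup>T\<close>, so they are orthogonal to themselves.\<close>

lemma least_squares_inverse_exists:
  fixes A :: "real mat"
  assumes A: "A \<in> carrier_mat nr nc"
  obtains L where "L \<in> carrier_mat nc nr" "A * L * A = A" "(A * L)\<^sup>T = A * L"
proof -
  define H where "H = A\<^sup>T * A"
  have H: "H \<in> carrier_mat nc nc" using A by (simp add: H_def)
  have HT: "H\<^sup>T = H" using A by (simp add: H_def transpose_mult_dim)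
  obtain G0 where G0: "G0 \<in> carrier_mat nc nc" "H * G0 * H = H"
    using generalized_inverse_exists[OF H] by blast
  \<comment> \<open>A generalized inverse of a symmetric matrix need not be symmetric; this sandwich
    is, and it is still a generalized inverse of \<open>H\<close>.\<close>
  define G where "G = G0 * H * G0\<^sup>T"
  have G: "G \<in> carrier_mat nc nc" using G0 H by (simp add: G_def)
  have GT: "G\<^sup>T = G" unfolding G_def using G0 H
    by (simp add: transpose_mult_dim HT mult_mat_assoc_dim)
  have H': "H * G0\<^sup>T * H = H"
  proof -
    have "H * G0\<^sup>T * H = (H * G0 * H)\<^sup>T" using G0(1) H
      by (simp add: transpose_mult_dim HT mult_mat_assoc_dim)
    then show ?thesis by (simp only: G0(2) HT)
  qed
  have HGH: "H * G * H = H"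
  proof -
    have "H * G * H = (H * G0 * H) * G0\<^sup>T * H" unfolding G_def using G0(1) H
      by (simp add: mult_mat_assoc_dim)
    then show ?thesis by (simp only: G0(2) H')
  qed
  define L where "L = G * A\<^sup>T"
  have L: "L \<in> carrier_mat nc nr" using G A by (simp add: L_def)
  have LA: "L * A = G * H" unfolding L_def H_def using G A
    by (simp add: mult_mat_assoc_dim)
  define Z where "Z = A * L * A - A"
  have Z: "Z \<in> carrier_mat nr nc" using A L unfolding Z_def by (intro minus_carrier_mat) auto
  have Z_eq: "Z = A * (G * H - 1\<^sub>m nc)"
    unfolding Z_def using A L G H LA
    by (simp add: mult_mat_assoc_dim mult_minus_distrib_mat[of _ nr nc _ nc])
  have "A\<^sup>T * Z = H * (G * H - 1\<^sub>m nc)"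
    unfolding Z_eq H_def using A G H by (simp add: mult_mat_assoc_dim H_def)
  also have "\<dots> = H * (G * H) - H * 1\<^sub>m nc"
    using H G by (intro mult_minus_distrib_mat[of _ nc nc _ nc]) auto
  also have "\<dots> = H - H" using HGH H G by (simp add: mult_mat_assoc_dim)
  also have "\<dots> = 0\<^sub>m nc nc" using H by simp
  finally have "A\<^sup>T * Z = 0\<^sub>m nc nc" .
  moreover have "Z\<^sup>T * Z = (G * H - 1\<^sub>m nc)\<^sup>T * (A\<^sup>T * Z)"
  proof -
    have "Z\<^sup>T = (G * H - 1\<^sub>m nc)\<^sup>T * A\<^sup>T"
      unfolding Z_eq using A G H by (intro transpose_mult[of _ nr nc _ nc]) auto
    then show ?thesis using A G H Z by (simp add: mult_mat_assoc_dim)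
  qed
  ultimately have "Z\<^sup>T * Z = 0\<^sub>m nc nc" using G H by simp
  then have Z0: "Z = 0\<^sub>m nr nc" by (rule gram_eq_0_imp_eq_0[OF Z])
  show thesis
  proof
    show "L \<in> carrier_mat nc nr" by (rule L)
    show "A * L * A = A"
    proof (rule eq_matI)
      fix i j assume ij: "i < dim_row A" "j < dim_col A"
      have "Z $$ (i, j) = (A * L * A) $$ (i, j) - A $$ (i, j)"
        unfolding Z_def using ij by simp
      then show "(A * L * A) $$ (i, j) = A $$ (i, j)" using Z0 ij A by simp
    qed (use A L in auto)
    show "(A * L)\<^sup>T = A * L" unfolding L_def using A G
      by (simp add: transpose_mult_dim GT mult_mat_assoc_dim)
  qed
qed

text \<open>Needed because \<open>pseudoinverse\<close> is a definite description. Symmetry forces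
  \<open>A * X\<close> and \<open>X * A\<close> to agree with the products formed with
  \<open>Y\<close>, and \<open>X\<close> is recovered as \<open>X * A * X\<close>.\<close>

lemma pseudoinverse_unique:
  assumes "is_pseudoinverse A X" "is_pseudoinverse A Y"
  shows "X = Y"
proof -
  define nr nc where "nr = dim_row A" and "nc = dim_col A"
  have A: "A \<in> carrier_mat nr nc" by (simp add: nr_def nc_def)
  have X: "X \<in> carrier_mat nc nr" "A * X * A = A" "X * A * X = X" "(A * X)\<^sup>T = A * X" "(X * A)\<^sup>T = X * A"
    and Y: "Y \<in> carrier_mat nc nr" "A * Y * A = A" "Y * A * Y = Y" "(A * Y)\<^sup>T = A * Y" "(Y * A)\<^sup>T = Y * A"
    using assms by (auto simp: is_pseudoinverse_def nr_def nc_def)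
  have "A * X = (A * X)\<^sup>T" using X by simp
  also have "\<dots> = (A * Y * A * X)\<^sup>T" by (simp only: Y(2))
  also have "A * Y * A * X = (A * Y) * (A * X)" using A X(1) Y(1) by (simp add: mult_mat_assoc_dim)
  also have "((A * Y) * (A * X))\<^sup>T = (A * X) * (A * Y)"
    using A X Y by (subst transpose_mult[of _ nr nr _ nr]) auto
  also have "\<dots> = (A * X * A) * Y" using A X(1) Y(1) by (simp add: mult_mat_assoc_dim)
  finally have AX: "A * X = A * Y" by (simp only: X(2))
  have "X * A = (X * A)\<^sup>T" using X by simp
  also have "\<dots> = (X * (A * Y * A))\<^sup>T" by (simp only: Y(2))
  also have "X * (A * Y * A) = (X * A) * (Y * A)" using A X(1) Y(1) by (simp add: mult_mat_assoc_dim)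
  also have "((X * A) * (Y * A))\<^sup>T = (Y * A) * (X * A)"
    using A X Y by (subst transpose_mult[of _ nc nc _ nc]) auto
  also have "\<dots> = Y * (A * X * A)" using A X(1) Y(1) by (simp add: mult_mat_assoc_dim)
  finally have XA: "X * A = Y * A" by (simp only: X(2))
  have "X = Y * A * X" by (simp only: X(3) XA[symmetric])
  also have "\<dots> = Y * (A * X)" using A X(1) Y(1) by (simp add: mult_mat_assoc_dim)
  also have "\<dots> = Y * A * Y" using A X(1) Y(1) by (simp add: AX mult_mat_assoc_dim)
  also have "\<dots> = Y" by (rule Y(3))
  finally show ?thesis .
qed

text \<open>Existence from two one-sided solutions: \<open>L\<close> makes \<open>A * L\<close>
  symmetric, and the same construction for the transpose gives \<open>R\<close> with
  \<open>R * A\<close> symmetric. Multiplying \<open>R * A * L\<close> by \<open>A\<close> on either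
  side collapses to \<open>A * L\<close> or \<open>R * A\<close>, so both symmetries
  survive.\<close>

lemma is_pseudoinverse_pseudoinverse: "is_pseudoinverse A (pseudoinverse A)"
proof -
  define nr nc where "nr = dim_row A" and "nc = dim_col A"
  have A: "A \<in> carrier_mat nr nc" by (simp add: nr_def nc_def)
  obtain L where L: "L \<in> carrier_mat nc nr" "A * L * A = A" "(A * L)\<^sup>T = A * L"
    using least_squares_inverse_exists[OF A] by blast
  obtain K where K: "K \<in> carrier_mat nr nc" "A\<^sup>T * K * A\<^sup>T = A\<^sup>T" "(A\<^sup>T * K)\<^sup>T = A\<^sup>T * K"
    using least_squares_inverse_exists[of "A\<^sup>T" nc nr] A by auto
  define R where "R = K\<^sup>T"
  have R: "R \<in> carrier_mat nc nr" using K by (simp add: R_def)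
  have RA: "(R * A)\<^sup>T = R * A" using K A
    by (metis R_def transpose_carrier_mat transpose_mult transpose_transpose)
  have "A * R * A = (A\<^sup>T * K * A\<^sup>T)\<^sup>T" unfolding R_def using K(1) A
    by (simp add: transpose_mult_dim mult_mat_assoc_dim)
  then have ARA: "A * R * A = A" by (simp only: K(2) transpose_transpose)
  define X where "X = R * A * L"
  have X: "X \<in> carrier_mat nc nr" using R L A by (simp add: X_def)
  have "A * X = (A * R * A) * L" unfolding X_def using A R L(1) by (simp add: mult_mat_assoc_dim)
  then have AX: "A * X = A * L" by (simp only: ARA)
  have "X * A = R * (A * L * A)" unfolding X_def using A R L(1) by (simp add: mult_mat_assoc_dim)
  then have XA: "X * A = R * A" by (simp only: L(2))
  have "X * A * X = R * (A * X)" unfolding XA using A R X by (simp add: mult_mat_assoc_dim)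
  also have "\<dots> = X" unfolding AX using A R L(1) by (simp add: X_def mult_mat_assoc_dim)
  finally have "X * A * X = X" .
  then have "is_pseudoinverse A X"
    unfolding is_pseudoinverse_def AX XA using X L(2,3) RA A by auto
  then show ?thesis
    unfolding pseudoinverse_def by (rule theI) (use pseudoinverse_unique \<open>is_pseudoinverse A X\<close> in blast)
qed


section \<open>Normal equations and minimization of quadratic forms\<close>

lemma scalar_prod_self_eq_0_imp:
  fixes v :: "real vec"
  assumes "v \<bullet> v = 0"
  shows "v = 0\<^sub>v (dim_vec v)"
proof (rule eq_vecI)
  fix i assume i: "i < dim_vec (0\<^sub>v (dim_vec v) :: real vec)"
  have "(\<Sum>k = 0..<dim_vec v. (v $ k)\<^sup>2) = 0"
    using assms by (simp add: scalar_prod_def power2_eq_square)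
  then have "\<forall>k\<in>{0..<dim_vec v}. (v $ k)\<^sup>2 = 0"
    by (subst (asm) sum_nonneg_eq_0_iff) auto
  then show "v $ i = 0\<^sub>v (dim_vec v) $ i" using i by auto
qed auto

lemma symmetric_mat_scalar_prod:
  fixes A :: "real mat"
  assumes "A \<in> carrier_mat n n" "A\<^sup>T = A" "x \<in> carrier_vec n" "y \<in> carrier_vec n"
  shows "(A *\<^sub>v x) \<bullet> y = x \<bullet> (A *\<^sub>v y)"
  using transpose_vec_mult_scalar[OF assms(1,4,3)] assms(2) by simp

text \<open>\<open>p\<close> is the orthogonal projection of \<open>r\<close> to the range of
  \<open>A\<close>. The residual \<open>q\<close> lies in the kernel of \<open>A\<close>, so it is
  orthogonal to \<open>p\<close> by symmetry and to \<open>r\<close> by assumption, hence to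
  itself.\<close>

lemma pseudoinverse_solves:
  fixes A :: "real mat"
  assumes A: "A \<in> carrier_mat n n" and sym: "A\<^sup>T = A" and r: "r \<in> carrier_vec n"
    and ker: "\<And>v. v \<in> carrier_vec n \<Longrightarrow> A *\<^sub>v v = 0\<^sub>v n \<Longrightarrow> r \<bullet> v = 0"
  shows "A *\<^sub>v (pseudoinverse A *\<^sub>v r) = r"
proof -
  define X where "X = pseudoinverse A"
  have X: "X \<in> carrier_mat n n" and AXA: "A * X * A = A" and AX: "(A * X)\<^sup>T = A * X"
    using is_pseudoinverse_pseudoinverse[of A] A by (auto simp: is_pseudoinverse_def X_def)
  define p where "p = A *\<^sub>v (X *\<^sub>v r)"
  define q where "q = r - p"
  have p: "p \<in> carrier_vec n" and q: "q \<in> carrier_vec n" and Xr: "X *\<^sub>v r \<in> carrier_vec n"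
    using A X r by (auto simp: p_def q_def)
  \<comment> \<open>For symmetric \<open>A\<close>, transposing \<open>A * X * A = A\<close> gives
    \<open>A * (A * X) = A\<close>, which puts the residual into the kernel.\<close>
  have "A * (A * X) = A\<^sup>T * (A * X)\<^sup>T" by (simp only: sym AX)
  also have "\<dots> = (A * X * A)\<^sup>T" using A X by (intro transpose_mult_dim[symmetric]) auto
  finally have AAX: "A * (A * X) = A" by (simp only: AXA sym)
  have "A *\<^sub>v p = (A * (A * X)) *\<^sub>v r"
    unfolding p_def using A X r by (simp add: assoc_mult_mat_vec[of _ n n _ n])
  then have "A *\<^sub>v q = 0\<^sub>v n"
    unfolding q_def using A r p by (simp add: mult_minus_distrib_mat_vec[of _ n n] AAX)
  then have "r \<bullet> q = 0" and "p \<bullet> q = 0"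
    using ker[OF q] symmetric_mat_scalar_prod[OF A sym Xr q] Xr by (auto simp: p_def)
  moreover have "q \<bullet> q = r \<bullet> q - p \<bullet> q"
    using minus_scalar_prod_distrib[OF r p q] by (simp add: q_def)
  ultimately have "q \<bullet> q = 0" by simp
  then have "q = 0\<^sub>v n" using scalar_prod_self_eq_0_imp[of q] q by simp
  then have "r - p = 0\<^sub>v n" by (simp add: q_def)
  have "p = r"
  proof (rule eq_vecI)
    fix i assume i: "i < dim_vec r"
    have "r $ i - p $ i = (r - p) $ i" using i p r by simp
    then show "p $ i = r $ i" using \<open>r - p = 0\<^sub>v n\<close> i r by simp
  qed (use p r in auto)
  then show ?thesis by (simp add: p_def X_def)
qed

text \<open>Completing the square: the two sides differ by the value of the form at
  \<open>z - z0\<close>, because the linear term is chosen so that \<open>z0\<close> is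
  critical.\<close>

lemma psd_quadratic_minimizer:
  fixes A :: "real mat"
  assumes A: "A \<in> carrier_mat n n" and sym: "A\<^sup>T = A"
    and psd: "\<And>v. v \<in> carrier_vec n \<Longrightarrow> 0 \<le> v \<bullet> (A *\<^sub>v v)"
    and z0: "z0 \<in> carrier_vec n" and z: "z \<in> carrier_vec n"
  shows "z0 \<bullet> (A *\<^sub>v z0) - 2 * ((A *\<^sub>v z0) \<bullet> z0) \<le> z \<bullet> (A *\<^sub>v z) - 2 * ((A *\<^sub>v z0) \<bullet> z)"
proof -
  define d where "d = z - z0"
  have d: "d \<in> carrier_vec n" using z z0 by (simp add: d_def)
  have Ac: "A *\<^sub>v z0 \<in> carrier_vec n" "A *\<^sub>v z \<in> carrier_vec n" using A z z0 by auto
  have "d \<bullet> (A *\<^sub>v d) = d \<bullet> (A *\<^sub>v z) - d \<bullet> (A *\<^sub>v z0)"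
    using d z z0 A Ac by (simp add: d_def mult_minus_distrib_mat_vec[of _ n n] scalar_prod_minus_distrib[of _ n])
  also have "\<dots> = z \<bullet> (A *\<^sub>v z) - z0 \<bullet> (A *\<^sub>v z) - (z \<bullet> (A *\<^sub>v z0) - z0 \<bullet> (A *\<^sub>v z0))"
    using z z0 Ac by (simp add: d_def minus_scalar_prod_distrib[of _ n])
  also have "z0 \<bullet> (A *\<^sub>v z) = (A *\<^sub>v z0) \<bullet> z"
    using symmetric_mat_scalar_prod[OF A sym z0 z] by simp
  also have "z \<bullet> (A *\<^sub>v z0) = (A *\<^sub>v z0) \<bullet> z" using z Ac by (simp add: comm_scalar_prod[of _ n])
  also have "z0 \<bullet> (A *\<^sub>v z0) = (A *\<^sub>v z0) \<bullet> z0" using z0 Ac by (simp add: comm_scalar_prod[of _ n])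
  finally have "d \<bullet> (A *\<^sub>v d) = z \<bullet> (A *\<^sub>v z) - 2 * ((A *\<^sub>v z0) \<bullet> z) + (A *\<^sub>v z0) \<bullet> z0" by simp
  moreover have "z0 \<bullet> (A *\<^sub>v z0) = (A *\<^sub>v z0) \<bullet> z0" using z0 Ac by (simp add: comm_scalar_prod[of _ n])
  ultimately show ?thesis using psd[OF d] by simp
qed

lemma smult_mult_mat_vec:
  fixes A :: "'a :: comm_ring_1 mat"
  assumes "A \<in> carrier_mat nr nc" "v \<in> carrier_vec nc"
  shows "(k \<cdot>\<^sub>m A) *\<^sub>v v = k \<cdot>\<^sub>v (A *\<^sub>v v)"
  using assms by (intro eq_vecI) (auto simp: scalar_prod_def sum_distrib_left mult_ac intro!: sum.cong)

text \<open>Stated for arbitrary matrices, so that splines enter later only through the symmetry and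
  positive semidefiniteness of \<open>M\<close> and through the range of \<open>R\<close>.\<close>

lemma regularized_least_squares:
  fixes B S M R :: "real mat" and f :: "real vec" and \<alpha> \<beta> :: real
  assumes B: "B \<in> carrier_mat nb np" and S: "S \<in> carrier_mat ns np" and M: "M \<in> carrier_mat ns ns"
    and R: "R \<in> carrier_mat np nz" and f: "f \<in> carrier_vec nb"
    and MT: "M\<^sup>T = M" and psd: "\<And>e. e \<in> carrier_vec ns \<Longrightarrow> 0 \<le> e \<bullet> (M *\<^sub>v e)"
    and pos: "0 < \<alpha>" "0 \<le> \<beta>"
    and z: "z \<in> carrier_vec nz"
  defines "\<phi> \<equiv> \<lambda>w. \<alpha> * ((f - B *\<^sub>v w) \<bullet> (f - B *\<^sub>v w)) + \<beta> * ((S *\<^sub>v w) \<bullet> (M *\<^sub>v (S *\<^sub>v w)))"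
    and "z0 \<equiv> pseudoinverse (R\<^sup>T * (\<beta> \<cdot>\<^sub>m (S\<^sup>T * M * S) + \<alpha> \<cdot>\<^sub>m (B\<^sup>T * B)) * R)
               *\<^sub>v (\<alpha> \<cdot>\<^sub>v (R\<^sup>T * B\<^sup>T *\<^sub>v f))"
  shows "z0 \<in> carrier_vec nz" "\<phi> (R *\<^sub>v z0) \<le> \<phi> (R *\<^sub>v z)"
proof -
  define G where "G = \<beta> \<cdot>\<^sub>m (S\<^sup>T * M * S) + \<alpha> \<cdot>\<^sub>m (B\<^sup>T * B)"
  have G: "G \<in> carrier_mat np np" unfolding G_def using S M B by auto
  have "(S\<^sup>T * M * S)\<^sup>T = S\<^sup>T * M * S" using S M
    by (simp add: transpose_mult_dim MT mult_mat_assoc_dim)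
  moreover have "(B\<^sup>T * B)\<^sup>T = B\<^sup>T * B" using B by (simp add: transpose_mult_dim)
  moreover have "(\<beta> \<cdot>\<^sub>m (S\<^sup>T * M * S))\<^sup>T = \<beta> \<cdot>\<^sub>m (S\<^sup>T * M * S)\<^sup>T" "(\<alpha> \<cdot>\<^sub>m (B\<^sup>T * B))\<^sup>T = \<alpha> \<cdot>\<^sub>m (B\<^sup>T * B)\<^sup>T"
    by (rule eq_matI; simp)+
  ultimately have GT: "G\<^sup>T = G" unfolding G_def using S M B
    by (simp add: transpose_add[of _ np np])
  define A where "A = R\<^sup>T * G * R"
  have A: "A \<in> carrier_mat nz nz" unfolding A_def using R G by auto
  have AT: "A\<^sup>T = A" unfolding A_def using R G
    by (simp add: transpose_mult_dim GT mult_mat_assoc_dim)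
  have Gw: "G *\<^sub>v w = \<beta> \<cdot>\<^sub>v (S\<^sup>T *\<^sub>v (M *\<^sub>v (S *\<^sub>v w))) + \<alpha> \<cdot>\<^sub>v (B\<^sup>T *\<^sub>v (B *\<^sub>v w))"
    if w: "w \<in> carrier_vec np" for w
  proof -
    have "G *\<^sub>v w = (\<beta> \<cdot>\<^sub>m (S\<^sup>T * M * S)) *\<^sub>v w + (\<alpha> \<cdot>\<^sub>m (B\<^sup>T * B)) *\<^sub>v w"
      unfolding G_def using S M B w by (intro add_mult_distrib_mat_vec[of _ np np]) auto
    also have "(\<beta> \<cdot>\<^sub>m (S\<^sup>T * M * S)) *\<^sub>v w = \<beta> \<cdot>\<^sub>v ((S\<^sup>T * M * S) *\<^sub>v w)"
      using S M w by (intro smult_mult_mat_vec[of _ np np]) auto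
    also have "(\<alpha> \<cdot>\<^sub>m (B\<^sup>T * B)) *\<^sub>v w = \<alpha> \<cdot>\<^sub>v ((B\<^sup>T * B) *\<^sub>v w)"
      using B w by (intro smult_mult_mat_vec[of _ np np]) auto
    also have "(S\<^sup>T * M * S) *\<^sub>v w = (S\<^sup>T * M) *\<^sub>v (S *\<^sub>v w)"
      using S M w by (intro assoc_mult_mat_vec[of _ np ns _ np]) auto
    also have "(S\<^sup>T * M) *\<^sub>v (S *\<^sub>v w) = S\<^sup>T *\<^sub>v (M *\<^sub>v (S *\<^sub>v w))"
      using S M w by (intro assoc_mult_mat_vec[of _ np ns _ ns]) auto
    also have "(B\<^sup>T * B) *\<^sub>v w = B\<^sup>T *\<^sub>v (B *\<^sub>v w)"
      using B w by (intro assoc_mult_mat_vec[of _ np nb _ np]) auto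
    finally show ?thesis .
  qed
  have wGw: "w \<bullet> (G *\<^sub>v w) = \<beta> * ((S *\<^sub>v w) \<bullet> (M *\<^sub>v (S *\<^sub>v w))) + \<alpha> * ((B *\<^sub>v w) \<bullet> (B *\<^sub>v w))"
    if w: "w \<in> carrier_vec np" for w
  proof -
    have *: "w \<bullet> (H\<^sup>T *\<^sub>v y) = (H *\<^sub>v w) \<bullet> y"
      if "H \<in> carrier_mat nr np" "y \<in> carrier_vec nr" for H :: "real mat" and y nr
    proof -
      have "w \<bullet> (H\<^sup>T *\<^sub>v y) = (H\<^sup>T *\<^sub>v y) \<bullet> w"
        using that w by (intro comm_scalar_prod[of _ np]) auto
      also have "\<dots> = y \<bullet> (H *\<^sub>v w)" using that w by (intro transpose_vec_mult_scalar) auto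
      also have "\<dots> = (H *\<^sub>v w) \<bullet> y" using that w by (intro comm_scalar_prod[of _ nr]) auto
      finally show ?thesis .
    qed
    have "w \<bullet> (G *\<^sub>v w) = w \<bullet> (\<beta> \<cdot>\<^sub>v (S\<^sup>T *\<^sub>v (M *\<^sub>v (S *\<^sub>v w)))) + w \<bullet> (\<alpha> \<cdot>\<^sub>v (B\<^sup>T *\<^sub>v (B *\<^sub>v w)))"
      unfolding Gw[OF w] using w S M B by (intro scalar_prod_add_distrib[of _ np]) auto
    also have "\<dots> = \<beta> * (w \<bullet> (S\<^sup>T *\<^sub>v (M *\<^sub>v (S *\<^sub>v w)))) + \<alpha> * (w \<bullet> (B\<^sup>T *\<^sub>v (B *\<^sub>v w)))"
      using w S M B by simp
    also have "w \<bullet> (S\<^sup>T *\<^sub>v (M *\<^sub>v (S *\<^sub>v w))) = (S *\<^sub>v w) \<bullet> (M *\<^sub>v (S *\<^sub>v w))"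
      using S M w by (intro *) auto
    also have "w \<bullet> (B\<^sup>T *\<^sub>v (B *\<^sub>v w)) = (B *\<^sub>v w) \<bullet> (B *\<^sub>v w)"
      using B w by (intro *) auto
    finally show ?thesis .
  qed
  have Av: "v \<bullet> (A *\<^sub>v v) = (R *\<^sub>v v) \<bullet> (G *\<^sub>v (R *\<^sub>v v))" if v: "v \<in> carrier_vec nz" for v
  proof -
    have "A *\<^sub>v v = (R\<^sup>T * G) *\<^sub>v (R *\<^sub>v v)"
      unfolding A_def using R G v by (intro assoc_mult_mat_vec[of _ nz np _ nz]) auto
    also have "\<dots> = R\<^sup>T *\<^sub>v (G *\<^sub>v (R *\<^sub>v v))"
      using R G v by (intro assoc_mult_mat_vec[of _ nz np _ np]) auto
    finally have "v \<bullet> (A *\<^sub>v v) = (R\<^sup>T *\<^sub>v (G *\<^sub>v (R *\<^sub>v v))) \<bullet> v"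
      using R G v by (simp add: comm_scalar_prod[of _ nz])
    also have "\<dots> = (G *\<^sub>v (R *\<^sub>v v)) \<bullet> (R *\<^sub>v v)"
      using R G v by (intro transpose_vec_mult_scalar) auto
    also have "\<dots> = (R *\<^sub>v v) \<bullet> (G *\<^sub>v (R *\<^sub>v v))"
      using R G v by (intro comm_scalar_prod[of _ np]) auto
    finally show ?thesis .
  qed
  have quad: "v \<bullet> (A *\<^sub>v v) = \<beta> * ((S *\<^sub>v (R *\<^sub>v v)) \<bullet> (M *\<^sub>v (S *\<^sub>v (R *\<^sub>v v))))
      + \<alpha> * ((B *\<^sub>v (R *\<^sub>v v)) \<bullet> (B *\<^sub>v (R *\<^sub>v v)))" if v: "v \<in> carrier_vec nz" for v
    unfolding Av[OF v] using R v by (intro wGw) auto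
  have sq: "0 \<le> y \<bullet> y" for y :: "real vec"
    unfolding scalar_prod_def by (intro sum_nonneg) simp
  have Mpos: "0 \<le> (S *\<^sub>v w) \<bullet> (M *\<^sub>v (S *\<^sub>v w))" if "w \<in> carrier_vec np" for w
    using S that by (intro psd) auto
  have Apsd: "0 \<le> v \<bullet> (A *\<^sub>v v)" if v: "v \<in> carrier_vec nz" for v
    unfolding quad[OF v] using pos R v Mpos[of "R *\<^sub>v v"] sq by auto
  define r where "r = \<alpha> \<cdot>\<^sub>v (R\<^sup>T * B\<^sup>T *\<^sub>v f)"
  have r: "r \<in> carrier_vec nz" unfolding r_def using R B f by auto
  have rv: "r \<bullet> v = \<alpha> * (f \<bullet> (B *\<^sub>v (R *\<^sub>v v)))" if v: "v \<in> carrier_vec nz" for v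
  proof -
    have "r \<bullet> v = \<alpha> * ((R\<^sup>T * B\<^sup>T *\<^sub>v f) \<bullet> v)" unfolding r_def using R B f v by simp
    also have "R\<^sup>T * B\<^sup>T = (B * R)\<^sup>T" using R B by (simp add: transpose_mult_dim)
    also have "((B * R)\<^sup>T *\<^sub>v f) \<bullet> v = f \<bullet> ((B * R) *\<^sub>v v)"
      using R B f v by (intro transpose_vec_mult_scalar[of _ nb nz]) auto
    also have "(B * R) *\<^sub>v v = B *\<^sub>v (R *\<^sub>v v)" using R B v by (intro assoc_mult_mat_vec) auto
    finally show ?thesis .
  qed
  \<comment> \<open>Both terms of the form are nonnegative, so both vanish. Since
    \<open>\<alpha>\<close> is positive, this gives \<open>B R v = 0\<close>, and \<open>r\<close>
    pairs with \<open>v\<close> only through \<open>B R v\<close>.\<close>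
  have ker: "r \<bullet> v = 0" if v: "v \<in> carrier_vec nz" and Av0: "A *\<^sub>v v = 0\<^sub>v nz" for v
  proof -
    have Rv: "R *\<^sub>v v \<in> carrier_vec np" using R v by auto
    have "0 = v \<bullet> (A *\<^sub>v v)" using v Av0 by simp
    then have "(B *\<^sub>v (R *\<^sub>v v)) \<bullet> (B *\<^sub>v (R *\<^sub>v v)) = 0"
      unfolding quad[OF v] using Mpos[OF Rv] sq[of "B *\<^sub>v (R *\<^sub>v v)"] pos
      by (metis add_nonneg_eq_0_iff less_imp_le mult_eq_0_iff mult_nonneg_nonneg order_less_irrefl)
    then have "B *\<^sub>v (R *\<^sub>v v) = 0\<^sub>v nb" using B scalar_prod_self_eq_0_imp by fastforce
    then show ?thesis using rv[OF v] f by simp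
  qed
  have z0_eq: "z0 = pseudoinverse A *\<^sub>v r" by (simp add: z0_def A_def G_def r_def)
  have "pseudoinverse A \<in> carrier_mat nz nz"
    using is_pseudoinverse_pseudoinverse[of A] A by (simp add: is_pseudoinverse_def)
  then show z0: "z0 \<in> carrier_vec nz" using r by (simp add: z0_eq)
  have Az0: "A *\<^sub>v z0 = r" unfolding z0_eq by (rule pseudoinverse_solves[OF A AT r ker])
  have phi: "\<phi> (R *\<^sub>v v) = \<alpha> * (f \<bullet> f) + (v \<bullet> (A *\<^sub>v v) - 2 * (r \<bullet> v))" if v: "v \<in> carrier_vec nz" for v
  proof -
    define y where "y = B *\<^sub>v (R *\<^sub>v v)"
    have y: "y \<in> carrier_vec nb" using B R v by (simp add: y_def)
    have "(f - y) \<bullet> (f - y) = f \<bullet> f - 2 * (f \<bullet> y) + y \<bullet> y"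
      using f y by (simp add: minus_scalar_prod_distrib[of _ nb] scalar_prod_minus_distrib[of _ nb]
          comm_scalar_prod[of y nb f])
    then have "\<alpha> * ((f - y) \<bullet> (f - y)) = \<alpha> * (f \<bullet> f - 2 * (f \<bullet> y) + y \<bullet> y)" by simp
    then show ?thesis
      unfolding \<phi>_def quad[OF v] rv[OF v] y_def[symmetric] by (simp add: algebra_simps)
  qed
  show "\<phi> (R *\<^sub>v z0) \<le> \<phi> (R *\<^sub>v z)"
    unfolding phi[OF z] phi[OF z0]
    using psd_quadratic_minimizer[OF A AT Apsd z0 z] by (simp add: Az0)
qed

section \<open>B-splines on clamped knots\<close>

text \<open>The knot \<open>t (g + 1)\<close> has its own premise because degree 0 compares with the
  right endpoint whatever the index \<open>i\<close> is.\<close>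

lemma bspline_cong:
  assumes "\<And>j. i \<le> j \<Longrightarrow> j \<le> i + int p + 1 \<Longrightarrow> t j = t' j" "t (int g + 1) = t' (int g + 1)"
  shows "bspline t g p i x = bspline t' g p i x"
  using assms(1)
proof (induction p arbitrary: i)
  case 0
  then show ?case using assms(2) by simp
next
  case (Suc p)
  have "bspline t g p i x = bspline t' g p i x" "bspline t g p (i + 1) x = bspline t' g p (i + 1) x"
    by (intro Suc; simp)+
  then show ?case using Suc.prems by simp
qed

text \<open>The knots are extended constantly in both directions. The Cox--de Boor recursion moves
  from \<open>i\<close> to \<open>i + 1\<close>; here statements hold for all integers
  \<open>i\<close>, with no index range to carry through the inductions.\<close>

locale clamped_knots =
  fixes g :: nat and a b :: real and t :: "int \<Rightarrow> real"
  assumes left: "i \<le> 0 \<Longrightarrow> t i = a"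
    and right: "int g + 1 \<le> i \<Longrightarrow> t i = b"
    and strict: "strict_mono_on {0..int g + 1} t"
begin

abbreviation "B \<equiv> bspline t g"

lemma mono_knots: "i \<le> j \<Longrightarrow> t i \<le> t j"
proof -
  assume "i \<le> j"
  have cl: "t m = t (max 0 (min (int g + 1) m))" for m
    using left[of m] left[of 0] right[of m] right[of "int g + 1"] by (auto simp: max_def min_def)
  have "t (max 0 (min (int g + 1) i)) \<le> t (max 0 (min (int g + 1) j))"
    using \<open>i \<le> j\<close> by (intro strict_mono_on_leD[OF strict]) auto
  then show ?thesis using cl[of i] cl[of j] by simp
qed

lemma knots_less: "i < j \<Longrightarrow> 0 \<le> i \<Longrightarrow> j \<le> int g + 1 \<Longrightarrow> t i < t j"
  using strict_mono_onD[OF strict] by auto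

lemma a_less_b: "a < b"
  using knots_less[of 0 "int g + 1"] left[of 0] right[of "int g + 1"] by simp

text \<open>The factor \<open>a - t i\<close> vanishes for \<open>i \<le> 0\<close>, so the single
  nonzero value is handed on by the second summand of the recursion, from index \<open>- p\<close>
  to \<open>- p - 1\<close>.\<close>

lemma bspline_0_left: "B p i a = (if i = - int p then 1 else 0)"
proof (induction p arbitrary: i)
  case 0
  have "t i \<le> a \<and> a < t (i + 1) \<longleftrightarrow> i = 0"
  proof
    assume *: "t i \<le> a \<and> a < t (i + 1)"
    then have "i + 1 > 0" using left[of "i + 1"] by force
    moreover have "\<not> 0 < i"
    proof
      assume "0 < i"
      then have "t 1 \<le> t i" by (intro mono_knots) simp
      then show False using * knots_less[of 0 1] left[of 0] by simp
    qed
    ultimately show "i = 0" by simp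
  qed (use knots_less[of 0 1] left[of 0] in simp)
  then show ?case using a_less_b right[of "int g + 1"] by auto
next
  case (Suc p)
  have 1: "(t (i + int p + 2) - a) / (t (i + int p + 2) - t (i + 1)) = 1" if "i + 1 = - int p"
  proof -
    have "i + int p + 2 = 1" "i + 1 \<le> 0" using that by auto
    then have "t (i + int p + 2) = t 1" "t (i + 1) = a" using left by (simp_all only:)
    then show ?thesis using knots_less[of 0 1] left[of 0] by simp
  qed
  show ?case
  proof (cases "i = - int p")
    case True
    then show ?thesis using left[of i] by (simp add: Suc)
  next
    case False
    then show ?thesis using 1 by (auto simp: Suc)
  qed
qed

text \<open>The mirror image at \<open>b\<close>, except that the base case rests on the closed last
  knot interval: with half-open intervals throughout, all B-splines would vanish at
  \<open>b\<close>.\<close>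

lemma bspline_right: "B p i b = (if i = int g then 1 else 0)"
proof (induction p arbitrary: i)
  case 0
  have "\<not> b < t (i + 1)" using mono_knots[of "i + 1" "max (i + 1) (int g + 1)"] right by force
  moreover have "t i < t (i + 1) \<and> t (i + 1) = b \<longleftrightarrow> i = int g"
  proof
    assume *: "t i < t (i + 1) \<and> t (i + 1) = b"
    then have "i < int g + 1" using right[of i] by force
    moreover have "\<not> i + 1 < int g + 1"
    proof
      assume "i + 1 < int g + 1"
      then have "t (i + 1) \<le> t (int g)" by (intro mono_knots) simp
      then show False using * knots_less[of "int g" "int g + 1"] right[of "int g + 1"] by simp
    qed
    ultimately show "i = int g" by simp
  qed (use knots_less[of "int g" "int g + 1"] right[of "int g + 1"] in auto)
  ultimately show ?case using right[of "int g + 1"] by auto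
next
  case (Suc p)
  have 1: "(b - t i) / (t (i + int p + 1) - t i) = 1" if "i = int g"
    using that right[of "i + int p + 1"] right[of "int g + 1"] knots_less[of "int g" "int g + 1"] by simp
  show ?case
  proof (cases "i + 1 = int g")
    case True
    then show ?thesis using right[of "i + int p + 2"] by (simp add: Suc)
  next
    case False
    then show ?thesis using 1 by (auto simp: Suc)
  qed
qed

text \<open>Degree 0 consists of step functions, so the continuity induction has to start here.
  Depending on the position of \<open>i\<close>, the function is zero, a hat, or half a hat at an
  endpoint where two of its three knots coincide.\<close>

lemma bspline_1_continuous: "continuous_on {a..b} (B (Suc 0) i)"
proof -
  have ab: "t 0 = a" "t (int g + 1) = b" using left right by auto
  consider "i \<le> -2" | "i = -1" | "0 \<le> i" "i < int g" | "i = int g" | "int g < i" by linarith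
  then show ?thesis
  proof cases
    case 1
    then have "t i = a" "t (i + 1) = a" "t (i + 2) = a" using left by auto
    then have "B (Suc 0) i = (\<lambda>x. 0)" using a_less_b ab by (intro ext) simp
    then show ?thesis by simp
  next
    case 2
    then have t: "t i = a" "t (i + 1) = a" "i + 2 = 1" using left by auto
    have t1: "a < t 1" "t 1 \<le> b" using knots_less[of 0 1] ab mono_knots[of 1 "int g + 1"] by auto
    have *: "B (Suc 0) i x = max 0 ((t 1 - x) / (t 1 - a))"
      if "x \<in> {a..b}" for x
      using that t1 t ab 2 by (auto simp: max_def divide_simps)
    have "continuous_on {a..b} (\<lambda>x. max 0 ((t 1 - x) / (t 1 - a)))"
      using t1 by (intro continuous_intros) auto
    then show ?thesis by (rule continuous_on_eq) (simp only: *)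
  next
    case 3
    have t: "t i < t (i + 1)" "t (i + 1) < t (i + 2)" "t (i + 2) \<le> b" "a \<le> t i"
      using knots_less[of i "i + 1"] knots_less[of "i + 1" "i + 2"] mono_knots[of "i + 2" "int g + 1"]
        mono_knots[of 0 i] 3 ab by auto
    \<comment> \<open>A hat is the smaller of its two lines cut off at zero. Continuity is immediate
      in this form, and the case split only matches it with the recursion.\<close>
    have *: "B (Suc 0) i x = max 0 (min ((x - t i) / (t (i + 1) - t i)) ((t (i + 2) - x) / (t (i + 2) - t (i + 1))))"
      if "x \<in> {a..b}" for x
    proof -
      have i: "i + int 0 + 1 = i + 1" "i + int 0 + 2 = i + 2" "i + 1 + 1 = i + 2" by auto
      consider "x < t i" | "t i \<le> x" "x < t (i + 1)" | "t (i + 1) \<le> x" "x < t (i + 2)"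
        | "t (i + 2) \<le> x" by linarith
      then show ?thesis
      proof cases
        case 1
        then have "(x - t i) / (t (i + 1) - t i) < 0" using t by (auto simp: divide_neg_pos)
        then have "max 0 (min ((x - t i) / (t (i + 1) - t i)) ((t (i + 2) - x) / (t (i + 2) - t (i + 1)))) = 0"
          by linarith
        then show ?thesis using 1 t ab by (simp add: i)
      next
        case 2
        then have "(x - t i) / (t (i + 1) - t i) \<le> 1" "1 \<le> (t (i + 2) - x) / (t (i + 2) - t (i + 1))"
          "0 \<le> (x - t i) / (t (i + 1) - t i)"
          using t by (auto simp: divide_simps)
        then have "max 0 (min ((x - t i) / (t (i + 1) - t i)) ((t (i + 2) - x) / (t (i + 2) - t (i + 1)))) = (x - t i) / (t (i + 1) - t i)"
          by linarith
        then show ?thesis using 2 t ab by (simp add: i)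
      next
        case 3
        then have "1 \<le> (x - t i) / (t (i + 1) - t i)" "(t (i + 2) - x) / (t (i + 2) - t (i + 1)) \<le> 1"
          "0 \<le> (t (i + 2) - x) / (t (i + 2) - t (i + 1))"
          using t by (auto simp: divide_simps)
        then have "max 0 (min ((x - t i) / (t (i + 1) - t i)) ((t (i + 2) - x) / (t (i + 2) - t (i + 1)))) = (t (i + 2) - x) / (t (i + 2) - t (i + 1))"
          by linarith
        then show ?thesis using 3 t ab by (simp add: i)
      next
        case 4
        then have "(t (i + 2) - x) / (t (i + 2) - t (i + 1)) \<le> 0" "0 \<le> (x - t i) / (t (i + 1) - t i)"
          using t by (auto simp: divide_simps)
        then have "max 0 (min ((x - t i) / (t (i + 1) - t i)) ((t (i + 2) - x) / (t (i + 2) - t (i + 1)))) = 0"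
          by linarith
        then show ?thesis using 4 t ab that by (auto simp: i)
      qed
    qed
    have "continuous_on {a..b} (\<lambda>x. max 0 (min ((x - t i) / (t (i + 1) - t i)) ((t (i + 2) - x) / (t (i + 2) - t (i + 1)))))"
      using t by (intro continuous_intros) auto
    then show ?thesis by (rule continuous_on_eq) (simp only: *)
  next
    case 4
    then have t: "t (i + 1) = b" "t (i + 2) = b" "t i < b" "a \<le> t i"
      using right knots_less[of "int g" "int g + 1"] mono_knots[of 0 i] ab by auto
    have *: "B (Suc 0) i x = max 0 ((x - t i) / (b - t i))"
      if "x \<in> {a..b}" for x
      using that t ab by (auto simp: max_def divide_simps)
    have "continuous_on {a..b} (\<lambda>x. max 0 ((x - t i) / (b - t i)))"
      using t by (intro continuous_intros) auto
    then show ?thesis by (rule continuous_on_eq) (simp only: *)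
  next
    case 5
    then have "t i = b" "t (i + 1) = b" "t (i + 2) = b" using right by auto
    then have "B (Suc 0) i = (\<lambda>x. 0)" using a_less_b ab by (intro ext) simp
    then show ?thesis by simp
  qed
qed

lemma bspline_continuous: "0 < p \<Longrightarrow> continuous_on {a..b} (B p i)"
proof (induction p arbitrary: i rule: nat_induct_non_zero)
  case 1
  show ?case using bspline_1_continuous by simp
next
  case (Suc p)
  have "B (Suc p) i = (\<lambda>x. (x - t i) / (t (i + int p + 1) - t i) * B p i x
     + (t (i + int p + 2) - x) / (t (i + int p + 2) - t (i + 1)) * B p (i + 1) x)" by (rule ext) simp
  then show ?case
    by (simp add: divide_inverse) (intro continuous_intros Suc)
qed

section \<open>Derivatives and integrals of B-splines on clamped knots\<close>

declare bspline.simps(2) [simp del]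

lemma bspline_0_derivative:
  assumes x: "a < x" "x < b" "x \<notin> range t"
  shows "(B 0 i has_field_derivative 0) (at x)"
proof -
  have b: "t (int g + 1) = b" using right by simp
  \<comment> \<open>A neighbourhood of \<open>x\<close> on which the step function is constant.
    Cutting it off at \<open>b\<close> excludes the point where the last interval is closed.\<close>
  define I where "I = (if t i < x \<and> x < t (i + 1) then {t i<..<t (i + 1)} \<inter> {a<..<b}
     else (if x < t i then {..<t i} \<inter> {a<..<b} else {t (i+1)<..<b}))"
  have "x \<noteq> t i" "x \<noteq> t (i + 1)" using x by auto
  then have xI: "x \<in> I" using x unfolding I_def by auto
  have "open I" unfolding I_def by auto
  have "B 0 i x = B 0 i y" if "y \<in> I" for y
    using that xI b mono_knots[of i "i + 1"] unfolding I_def by (auto split: if_splits)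
  then show ?thesis
    by (rule has_field_derivative_transform_within_open[OF DERIV_const \<open>open I\<close> xI])
qed

text \<open>The classical derivative formula, indexed by the degree after differentiation: it
  belongs to \<open>B (Suc p) i\<close>. Quotients over coincident knots are zero.\<close>

definition bspline_deriv :: "nat \<Rightarrow> int \<Rightarrow> real \<Rightarrow> real" where
  "bspline_deriv p i x = real (p + 1) *
     (B p i x / (t (i + int p + 1) - t i) - B p (i + 1) x / (t (i + int p + 2) - t (i + 1)))"

text \<open>The left-hand side is what the product rule makes of the recursion for degree
  \<open>p + 2\<close>. Expanded in the three scaled B-splines \<open>X\<close>, \<open>Y\<close>,
  \<open>Z\<close> of degree \<open>p\<close>, the coefficients of \<open>X\<close> and
  \<open>Z\<close> agree at once, and that of \<open>Y\<close> agrees because weights over a common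
  denominator sum to one.\<close>

lemma bspline_deriv_rec:
  "B (Suc p) i x / (t (i + int p + 2) - t i) - B (Suc p) (i + 1) x / (t (i + int p + 3) - t (i + 1))
     + (x - t i) / (t (i + int p + 2) - t i) * bspline_deriv p i x
     + (t (i + int p + 3) - x) / (t (i + int p + 3) - t (i + 1)) * bspline_deriv p (i + 1) x
   = bspline_deriv (Suc p) i x"
proof -
  define t0 t1 t2 s0 s1 s2 where "t0 = t i" and "t1 = t (i + 1)" and "t2 = t (i + 2)"
    and "s0 = t (i + int p + 1)" and "s1 = t (i + int p + 2)" and "s2 = t (i + int p + 3)"
  define X Y Z where "X = B p i x / (s0 - t0)" and "Y = B p (i + 1) x / (s1 - t1)"
    and "Z = B p (i + 2) x / (s2 - t2)"
  have idx: "i + 1 + int p + 1 = i + int p + 2" "i + 1 + int p + 2 = i + int p + 3" "i + 1 + 1 = i + 2"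
    "i + int (Suc p) + 1 = i + int p + 2" "i + int (Suc p) + 2 = i + int p + 3" by auto
  have B1: "B (Suc p) i x = (x - t0) * X + (s1 - x) * Y"
    by (simp add: X_def Y_def t0_def t1_def s0_def s1_def bspline.simps(2))
  have B2: "B (Suc p) (i + 1) x = (x - t1) * Y + (s2 - x) * Z"
    by (simp add: Y_def Z_def t1_def t2_def s1_def s2_def idx bspline.simps(2))
  have d1: "bspline_deriv p i x = real (p + 1) * (X - Y)"
    by (simp add: bspline_deriv_def X_def Y_def t0_def t1_def s0_def s1_def)
  have d2: "bspline_deriv p (i + 1) x = real (p + 1) * (Y - Z)"
    by (simp add: bspline_deriv_def Z_def Y_def t1_def t2_def s1_def s2_def idx)
  have le: "t0 \<le> t1" "t1 \<le> s1" "s1 \<le> s2"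
    unfolding t0_def t1_def s1_def s2_def by (intro mono_knots; simp)+
  \<comment> \<open>If \<open>s1 = t1\<close>, then \<open>Y\<close> is zero by division by zero;
    otherwise monotonicity makes both denominators positive.\<close>
  have "((s1 - x) / (s1 - t0) - (x - t1) / (s2 - t1)) * Y
      = (- (x - t0) / (s1 - t0) + (s2 - x) / (s2 - t1)) * Y"
  proof (cases "s1 = t1")
    case False
    then have "s1 - t0 \<noteq> 0" "s2 - t1 \<noteq> 0" using le by auto
    then have "(s1 - x) / (s1 - t0) - (x - t1) / (s2 - t1) = - (x - t0) / (s1 - t0) + (s2 - x) / (s2 - t1)"
      by (simp add: field_simps)
    then show ?thesis by simp
  qed (simp add: Y_def)
  then have "((x - t0) * X + (s1 - x) * Y) / (s1 - t0) - ((x - t1) * Y + (s2 - x) * Z) / (s2 - t1)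
      = (x - t0) / (s1 - t0) * (X - Y) + (s2 - x) / (s2 - t1) * (Y - Z)"
    by (simp add: add_divide_distrib diff_divide_distrib algebra_simps)
  then have "real (p + 1) * (B (Suc p) i x / (s1 - t0) - B (Suc p) (i + 1) x / (s2 - t1))
      = (x - t0) / (s1 - t0) * bspline_deriv p i x + (s2 - x) / (s2 - t1) * bspline_deriv p (i + 1) x"
    unfolding B1 B2 d1 d2 by (simp only: distrib_left mult_ac)
  moreover have "bspline_deriv (Suc p) i x
      = (real (p + 1) + 1) * (B (Suc p) i x / (s1 - t0) - B (Suc p) (i + 1) x / (s2 - t1))"
    unfolding bspline_deriv_def t0_def t1_def s1_def s2_def idx by simp
  ultimately show ?thesis
    unfolding t0_def[symmetric] t1_def[symmetric] s1_def[symmetric] s2_def[symmetric] distrib_right mult_1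
    by linarith
qed

lemma bspline_has_derivative_off_knots:
  assumes x: "a < x" "x < b" "x \<notin> range t"
  shows "(B (Suc p) i has_field_derivative bspline_deriv p i x) (at x)"
proof (induction p arbitrary: i)
  case 0
  have "((\<lambda>x. (x - t i) / (t (i + 1) - t i) * B 0 i x + (t (i + 2) - x) / (t (i + 2) - t (i + 1)) * B 0 (i + 1) x)
      has_field_derivative bspline_deriv 0 i x) (at x)"
    unfolding divide_inverse
    by (rule derivative_eq_intros bspline_0_derivative[OF x] refl)+
      (simp add: bspline_deriv_def divide_inverse algebra_simps del: bspline.simps)
  moreover have "B (Suc 0) i = (\<lambda>x. (x - t i) / (t (i + 1) - t i) * B 0 i x + (t (i + 2) - x) / (t (i + 2) - t (i + 1)) * B 0 (i + 1) x)"
    by (rule ext) (simp only: bspline.simps(2) of_nat_0 add_0_right)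
  ultimately show ?case by (simp only:)
next
  case (Suc p)
  have idx: "i + int (Suc p) + 1 = i + int p + 2" "i + int (Suc p) + 2 = i + int p + 3" by auto
  have "((\<lambda>x. (x - t i) / (t (i + int p + 2) - t i) * B (Suc p) i x
      + (t (i + int p + 3) - x) / (t (i + int p + 3) - t (i + 1)) * B (Suc p) (i + 1) x)
      has_field_derivative bspline_deriv (Suc p) i x) (at x)"
    unfolding bspline_deriv_rec[symmetric] divide_inverse
    by (rule derivative_eq_intros Suc refl)+
      (simp add: divide_inverse algebra_simps del: bspline.simps)
  moreover have "B (Suc (Suc p)) i = (\<lambda>x. (x - t i) / (t (i + int p + 2) - t i) * B (Suc p) i x
      + (t (i + int p + 3) - x) / (t (i + int p + 3) - t (i + 1)) * B (Suc p) (i + 1) x)"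
    by (rule ext) (simp only: bspline.simps(2)[of _ _ "Suc p"] idx)
  ultimately show ?case by (simp only:)
qed

text \<open>The knots are the exceptional points in the fundamental theorem of calculus, which
  tolerates finitely many.\<close>

lemma finite_range_knots: "finite (range t)"
proof -
  have "range t \<subseteq> t ` {0..int g + 1}"
  proof
    fix y assume "y \<in> range t"
    then obtain i where i: "y = t i" by auto
    consider "i \<le> 0" | "i \<in> {0..int g + 1}" | "int g + 1 \<le> i" by fastforce
    then show "y \<in> t ` {0..int g + 1}"
    proof cases
      case 1
      then show ?thesis using i left[of i] left[of 0] by (auto intro!: image_eqI[of _ _ 0])
    next
      case 3
      then show ?thesis using i right[of i] right[of "int g + 1"]
        by (auto intro!: image_eqI[of _ _ "int g + 1"])
    qed (use i in auto)
  qed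
  then show ?thesis by (rule finite_subset) auto
qed

text \<open>At a knot the Cox--de Boor recursion cannot be differentiated directly, because splines of
  degree 1 have kinks there; but the formula valid off the knots is continuous, so it integrates
  to the spline.\<close>

lemma bspline_has_vector_derivative:
  assumes p: "0 < p" and x: "x \<in> {a..b}"
  shows "(B (Suc p) i has_vector_derivative bspline_deriv p i x) (at x within {a..b})"
proof -
  have cont: "continuous_on {a..b} (bspline_deriv p i)"
    unfolding bspline_deriv_def divide_inverse
    by (intro continuous_intros bspline_continuous p)
  have ftc: "(bspline_deriv p i has_integral (B (Suc p) i y - B (Suc p) i a)) {a..y}"
    if y: "y \<in> {a..b}" for y
  proof (rule fundamental_theorem_of_calculus_interior_strong[OF finite_range_knots])
    show "a \<le> y" using y by simp
    show "(B (Suc p) i has_vector_derivative bspline_deriv p i z) (at z)"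
      if "z \<in> {a<..<y} - range t" for z
      using bspline_has_derivative_off_knots[of z p i] that y
      by (auto simp: has_real_derivative_iff_has_vector_derivative)
    show "continuous_on {a..y} (B (Suc p) i)"
      using y by (intro continuous_on_subset[OF bspline_continuous]) auto
  qed
  have "((\<lambda>y. integral {a..y} (bspline_deriv p i)) has_vector_derivative bspline_deriv p i x) (at x within {a..b})"
    by (rule integral_has_vector_derivative[OF cont x])
  then have "((\<lambda>y. B (Suc p) i a + integral {a..y} (bspline_deriv p i)) has_vector_derivative bspline_deriv p i x) (at x within {a..b})"
    using has_vector_derivative_add[OF has_vector_derivative_const] by fastforce
  then show ?thesis
    by (rule has_vector_derivative_transform[OF x, rotated])
      (simp add: integral_unique[OF ftc])
qed


text \<open>Each B-spline of degree \<open>p\<close> occurs in the derivatives of two neighbours, so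
  summation by parts collects coefficient differences. The two boundary terms belong to knot spans
  of length zero, which is why one coefficient fewer remains.\<close>

lemma spline_has_vector_derivative:
  assumes p: "0 < p" and x: "x \<in> {a..b}"
  shows "((\<lambda>x. \<Sum>r<g + p + 2. \<beta> r * B (Suc p) (int r - int (Suc p)) x) has_vector_derivative
    (\<Sum>r<g + p + 1. real (p + 1) / (t (int r + 1) - t (int r - int p)) * (\<beta> (r + 1) - \<beta> r)
       * B p (int r - int p) x)) (at x within {a..b})"
proof -
  define w where "w r = real (p + 1) * B p (int r - int p - 1) x / (t (int r) - t (int r - int p - 1))" for r
  have w: "bspline_deriv p (int r - int (Suc p)) x = w r - w (r + 1)" for r
  proof -
    have "int r - int (Suc p) = int r - int p - 1" "int r - int p - 1 + int p + 1 = int r"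
      "int r - int p - 1 + 1 = int (r + 1) - int p - 1" "int r - int p - 1 + int p + 2 = int (r + 1)" by auto
    then show ?thesis
      unfolding bspline_deriv_def w_def by (simp only: times_divide_eq_right right_diff_distrib)
  qed
  have by_parts: "(\<Sum>r<Suc n. \<beta> r * (w r - w (r + 1)))
      = \<beta> 0 * w 0 - \<beta> n * w (n + 1) + (\<Sum>r<n. (\<beta> (r + 1) - \<beta> r) * w (r + 1))" for n
    by (induction n) (auto simp: algebra_simps)
  have "((\<lambda>x. \<Sum>r<g + p + 2. \<beta> r * B (Suc p) (int r - int (Suc p)) x) has_vector_derivative
      (\<Sum>r<g + p + 2. \<beta> r * bspline_deriv p (int r - int (Suc p)) x)) (at x within {a..b})"
    by (intro has_vector_derivative_sum has_vector_derivative_mult_right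
        bspline_has_vector_derivative p x)
  also have "(\<Sum>r<g + p + 2. \<beta> r * bspline_deriv p (int r - int (Suc p)) x)
      = (\<Sum>r<Suc (g + p + 1). \<beta> r * (w r - w (r + 1)))"
    by (rule sum.cong, simp, simp only: w)
  also have "\<dots> = (\<Sum>r<g + p + 1. (\<beta> (r + 1) - \<beta> r) * w (r + 1))"
  proof -
    \<comment> \<open>The last \<open>w\<close> has the knots \<open>t (g + 1)\<close> and
      \<open>t (g + p + 2)\<close>, both equal to \<open>b\<close>, and \<open>w 0\<close> has both
      knots at \<open>a\<close>. Division by zero turns both terms into zero.\<close>
    have "int (g + p + 1 + 1) - int p - 1 = int g + 1" by simp
    then have "w (g + p + 1 + 1) = 0"
      using right[of "int g + 1"] right[of "int (g + p + 1 + 1)"] by (simp only: w_def) simp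
    moreover have "w 0 = 0" using left[of 0] left[of "- int p - 1"] by (simp add: w_def)
    ultimately show ?thesis by (simp only: by_parts)
  qed
  also have "\<dots> = (\<Sum>r<g + p + 1. real (p + 1) / (t (int r + 1) - t (int r - int p)) * (\<beta> (r + 1) - \<beta> r)
       * B p (int r - int p) x)"
  proof (rule sum.cong[OF refl])
    fix r
    have "int (r + 1) - int p - 1 = int r - int p" "int (r + 1) = int r + 1" by auto
    then show "(\<beta> (r + 1) - \<beta> r) * w (r + 1) = real (p + 1) / (t (int r + 1) - t (int r - int p))
        * (\<beta> (r + 1) - \<beta> r) * B p (int r - int p) x"
      unfolding w_def by (simp only: times_divide_eq_right times_divide_eq_left mult_ac)
  qed
  finally show ?thesis .
qed

text \<open>A single B-spline is the derivative of a spline of the next degree whose coefficients jump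
  once from 0 to 1, and so is its integral.\<close>

lemma bspline_has_integral:
  assumes p: "0 < p" and r: "r < g + p + 1"
  shows "(B p (int r - int p) has_integral (t (int r + 1) - t (int r - int p)) / real (p + 1)) {a..b}"
proof -
  define \<beta> :: "nat \<Rightarrow> real" where "\<beta> s = (if r < s then 1 else 0)" for s
  define F where "F x = (\<Sum>s<g + p + 2. \<beta> s * B (Suc p) (int s - int (Suc p)) x)" for x
  define h where "h = t (int r + 1) - t (int r - int p)"
  have "h > 0"
  proof -
    \<comment> \<open>\<open>max\<close> and \<open>min\<close> move the ends of the support into
      the index range \<open>0..g + 1\<close>, where the knots increase strictly.\<close>
    have "t (max 0 (int r - int p)) < t (min (int g + 1) (int r + 1))"
      using r by (intro knots_less) auto
    moreover have "t (int r - int p) \<le> t (max 0 (int r - int p))" by (intro mono_knots) simp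
    moreover have "t (min (int g + 1) (int r + 1)) \<le> t (int r + 1)" by (intro mono_knots) simp
    ultimately show ?thesis by (simp add: h_def)
  qed
  have "(F has_vector_derivative (real (p + 1) / h * B p (int r - int p) x)) (at x within {a..b})"
    if "x \<in> {a..b}" for x
  proof -
    have "(\<Sum>s<g + p + 1. real (p + 1) / (t (int s + 1) - t (int s - int p)) * (\<beta> (s + 1) - \<beta> s)
       * B p (int s - int p) x) = (\<Sum>s<g + p + 1. if s = r then real (p + 1) / h * B p (int r - int p) x else 0)"
      by (intro sum.cong) (auto simp: \<beta>_def h_def)
    also have "\<dots> = real (p + 1) / h * B p (int r - int p) x" using r by (subst sum.delta) auto
    finally show ?thesis
      using spline_has_vector_derivative[OF p that, of \<beta>] unfolding F_def[abs_def] by (simp only:)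
  qed
  then have "((\<lambda>x. real (p + 1) / h * B p (int r - int p) x) has_integral (F b - F a)) {a..b}"
    using a_less_b by (intro fundamental_theorem_of_calculus) auto
  \<comment> \<open>At \<open>b\<close> only the last B-spline is nonzero, and its coefficient lies
    after the jump; at \<open>a\<close> only the first one is, with its coefficient before the
    jump.\<close>
  moreover have "F b = 1"
  proof -
    have "F b = (\<Sum>s<g + p + 2. if s = g + p + 1 then 1 else 0)"
      unfolding F_def using r by (intro sum.cong) (auto simp: bspline_right \<beta>_def)
    then show ?thesis by simp
  qed
  moreover have "F a = 0"
    unfolding F_def by (intro sum.neutral) (auto simp: bspline_0_left \<beta>_def)
  ultimately have "((\<lambda>x. h / real (p + 1) * (real (p + 1) / h * B p (int r - int p) x)) has_integral
      h / real (p + 1) * 1) {a..b}"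
    by (intro has_integral_mult_right) simp
  then show ?thesis using \<open>h > 0\<close> by (simp add: h_def)
qed

end

section \<open>Transfer between given and clamped knot sequences\<close>

text \<open>\<open>extended_knots\<close> leaves the values outside
  \<open>- k, ..., g + k + 1\<close> open; moving the index into \<open>0..g + 1\<close> replaces
  them by the endpoints.\<close>

definition clamp_knots :: "(int \<Rightarrow> real) \<Rightarrow> nat \<Rightarrow> int \<Rightarrow> real" where
  "clamp_knots t g i = t (max 0 (min (int g + 1) i))"

lemma clamped_knots_clamp:
  assumes "extended_knots k g a b t"
  shows "clamped_knots g a b (clamp_knots t g)"
proof
  show "strict_mono_on {0..int g + 1} (clamp_knots t g)"
    using assms by (auto simp: extended_knots_def clamp_knots_def strict_mono_on_def)
qed (use assms in \<open>auto simp: extended_knots_def clamp_knots_def\<close>)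

lemma clamp_knots_eq:
  assumes "extended_knots k g a b t" "- int k \<le> i" "i \<le> int g + int k + 1"
  shows "clamp_knots t g i = t i"
proof -
  have *: "t 0 = a" "t (int g + 1) = b" "\<And>i. i \<in> {- int k..-1} \<Longrightarrow> t i = a"
    "\<And>i. i \<in> {int g + 2..int g + int k + 1} \<Longrightarrow> t i = b"
    using assms(1) by (auto simp: extended_knots_def)
  consider "i \<in> {- int k..-1}" | "i \<in> {0..int g + 1}" | "i \<in> {int g + 2..int g + int k + 1}"
    using assms(2,3) by fastforce
  then show ?thesis
    by cases (use * in \<open>auto simp: clamp_knots_def max_def min_def\<close>)
qed

text \<open>B-splines of degree \<open>p \<le> k\<close> in this index range see only knots between
  \<open>- k\<close> and \<open>g + k + 1\<close>, where clamping changes nothing.\<close>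

lemma bspline_clamp:
  assumes "extended_knots k g a b t" "p \<le> k" "r < g + p + 1"
  shows "bspline (clamp_knots t g) g p (int r - int p) = bspline t g p (int r - int p)"
  by (rule ext, rule bspline_cong) (use assms in \<open>auto intro!: clamp_knots_eq\<close>)

lemma extended_knots_less:
  assumes "extended_knots k g a b t"
  shows "a < b"
  using clamped_knots.a_less_b[OF clamped_knots_clamp[OF assms]] .

lemma extended_knots_support_less:
  assumes t: "extended_knots k g a b t" and r: "r < g + k + 1"
  shows "t (int r - int k) < t (int r + 1)"
proof -
  interpret clamped_knots g a b "clamp_knots t g" by (rule clamped_knots_clamp[OF t])
  have "clamp_knots t g (max 0 (int r - int k)) < clamp_knots t g (min (int g + 1) (int r + 1))"
    using r by (intro knots_less) auto
  moreover have "clamp_knots t g (int r - int k) \<le> clamp_knots t g (max 0 (int r - int k))"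
    by (intro mono_knots) simp
  moreover have "clamp_knots t g (min (int g + 1) (int r + 1)) \<le> clamp_knots t g (int r + 1)"
    by (intro mono_knots) simp
  ultimately have "clamp_knots t g (int r - int k) < clamp_knots t g (int r + 1)" by simp
  then show ?thesis using clamp_knots_eq[OF t, of "int r - int k"] clamp_knots_eq[OF t, of "int r + 1"] r
    by simp
qed

lemma extended_bspline_continuous:
  assumes "extended_knots k g a b t" "0 < p" "p \<le> k" "r < g + p + 1"
  shows "continuous_on {a..b} (bspline t g p (int r - int p))"
  using clamped_knots.bspline_continuous[OF clamped_knots_clamp[OF assms(1)] assms(2)]
  by (simp flip: bspline_clamp[OF assms(1,3,4)])

lemma extended_bspline_has_integral:
  assumes t: "extended_knots k g a b t" and k: "0 < k" and r: "r < g + k + 1"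
  shows "(bspline t g k (int r - int k) has_integral (t (int r + 1) - t (int r - int k)) / real (k + 1)) {a..b}"
  using clamped_knots.bspline_has_integral[OF clamped_knots_clamp[OF t] k r]
    clamp_knots_eq[OF t, of "int r - int k"] clamp_knots_eq[OF t, of "int r + 1"] r
  by (simp add: bspline_clamp[OF t le_refl r])

lemma extended_spline_has_vector_derivative:
  assumes t: "extended_knots k g a b t" and p: "0 < p" "p < k" and x: "x \<in> {a..b}"
  shows "((\<lambda>x. \<Sum>r<g + p + 2. \<beta> r * bspline t g (Suc p) (int r - int (Suc p)) x) has_vector_derivative
    (\<Sum>r<g + p + 1. real (p + 1) / (t (int r + 1) - t (int r - int p)) * (\<beta> (r + 1) - \<beta> r)
       * bspline t g p (int r - int p) x)) (at x within {a..b})"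
proof -
  let ?c = "clamp_knots t g"
  have "(\<Sum>r<g + p + 2. \<beta> r * bspline ?c g (Suc p) (int r - int (Suc p)) y)
      = (\<Sum>r<g + p + 2. \<beta> r * bspline t g (Suc p) (int r - int (Suc p)) y)" for y
    using p by (intro sum.cong refl) (auto simp: bspline_clamp[OF t] simp del: of_nat_Suc)
  moreover have "(\<Sum>r<g + p + 1. real (p + 1) / (?c (int r + 1) - ?c (int r - int p)) * (\<beta> (r + 1) - \<beta> r)
       * bspline ?c g p (int r - int p) x)
      = (\<Sum>r<g + p + 1. real (p + 1) / (t (int r + 1) - t (int r - int p)) * (\<beta> (r + 1) - \<beta> r)
       * bspline t g p (int r - int p) x)"
    using p by (intro sum.cong refl) (auto simp: bspline_clamp[OF t] clamp_knots_eq[OF t])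
  ultimately show ?thesis
    using clamped_knots.spline_has_vector_derivative[OF clamped_knots_clamp[OF t] p(1) x, of \<beta>]
    by (simp only:)
qed

section \<open>Derivative matrices acting on spline coefficients\<close>

lemma diff_mat_sum:
  assumes "i < N"
  shows "(\<Sum>q<N + 1. diff_mat N $$ (i, q) * f q) = f (i + 1) - f i"
proof -
  have "(\<Sum>q<N + 1. diff_mat N $$ (i, q) * f q)
      = (\<Sum>q<N + 1. (if q = i + 1 then f q else 0) - (if q = i then f q else 0))"
    using assms by (intro sum.cong) (auto simp: diff_mat_def)
  then show ?thesis using assms by (simp add: sum_subtractf del: sum.lessThan_Suc)
qed

lemma knot_diag_carrier: "knot_diag t g k j \<in> carrier_mat (g + k + 1 - j) (g + k + 1 - j)"
  by (simp add: knot_diag_def mat_diag_def)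

lemma diff_mat_carrier: "diff_mat N \<in> carrier_mat N (N + 1)"
  by (simp add: diff_mat_def)

text \<open>In this numbering the upper knot is \<open>r + 1\<close> for every \<open>j\<close>:
  differentiation moves only the lower knot.\<close>

lemma knot_diag_index:
  assumes "r < g + k + 1 - j" "q < g + k + 1 - j"
  shows "knot_diag t g k j $$ (r, q) = (if r = q then real (k + 1 - j) /
     (t (int r + 1) - t (int r - int k + int j)) else 0)"
proof -
  have "int r - int k + int j + int k + 1 - int j = int r + 1" by simp
  then show ?thesis using assms by (auto simp: knot_diag_def mat_diag_def Let_def)
qed

lemma deriv_mat_carrier:
  "u \<le> k \<Longrightarrow> deriv_mat t g k u \<in> carrier_mat (g + k + 1 - u) (g + k + 1)"
proof (induction u)
  case (Suc u)
  have "diff_mat (g + k + 1 - Suc u) \<in> carrier_mat (g + k + 1 - Suc u) (g + k + 1 - u)"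
    using diff_mat_carrier[of "g + k + 1 - Suc u"] Suc.prems by (simp add: Suc_diff_le)
  with Suc show ?case
    unfolding deriv_mat.simps
    by (intro mult_carrier_mat[of _ _ "g + k + 1 - u"] mult_carrier_mat[of _ _ "g + k + 1 - Suc u"]
        knot_diag_carrier) auto
qed simp

text \<open>This is the coefficient rule of \<open>spline_has_vector_derivative\<close> with
  \<open>k - u - 1\<close> in place of \<open>p\<close>.\<close>

lemma deriv_mat_Suc_index:
  assumes "Suc u \<le> k" "r < g + k - u" "q < g + k + 1"
  shows "deriv_mat t g k (Suc u) $$ (r, q) = real (k - u) / (t (int r + 1) - t (int r - int k + int u + 1))
     * (deriv_mat t g k u $$ (r + 1, q) - deriv_mat t g k u $$ (r, q))"
proof -
  define N where "N = g + k + 1 - Suc u"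
  have N: "N + 1 = g + k + 1 - u" "r < N" using assms by (auto simp: N_def)
  let ?K = "knot_diag t g k (Suc u)" and ?D = "diff_mat N" and ?S = "deriv_mat t g k u"
  have K: "?K \<in> carrier_mat N N" using knot_diag_carrier[of t g k "Suc u"] by (simp add: N_def)
  have D: "?D \<in> carrier_mat N (N + 1)" by (rule diff_mat_carrier)
  have S: "?S \<in> carrier_mat (N + 1) (g + k + 1)"
    unfolding N(1) by (rule deriv_mat_carrier) (use assms in simp)
  define \<kappa> where "\<kappa> = real (k - u) / (t (int r + 1) - t (int r - int k + int u + 1))"
  have \<kappa>: "?K $$ (r, s) = (if s = r then \<kappa> else 0)" if "s < N" for s
    using N(2) that by (subst knot_diag_index) (auto simp: N_def \<kappa>_def ac_simps)
  have KD: "(?K * ?D) $$ (r, s) = \<kappa> * ?D $$ (r, s)" if "s < N + 1" for s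
  proof -
    have "(?K * ?D) $$ (r, s) = (\<Sum>s'<N. ?K $$ (r, s') * ?D $$ (s', s))"
      by (rule index_mult_mat_sum[OF K D N(2) that])
    also have "\<dots> = (\<Sum>s'<N. if s' = r then \<kappa> * ?D $$ (r, s) else 0)"
      by (intro sum.cong) (auto simp: \<kappa>)
    also have "\<dots> = \<kappa> * ?D $$ (r, s)" using N(2) by simp
    finally show ?thesis .
  qed
  have "(?K * ?D * ?S) $$ (r, q) = (\<Sum>s<N + 1. (?K * ?D) $$ (r, s) * ?S $$ (s, q))"
    by (rule index_mult_mat_sum[OF mult_carrier_mat[OF K D] S N(2) assms(3)])
  also have "\<dots> = \<kappa> * (\<Sum>s<N + 1. ?D $$ (r, s) * ?S $$ (s, q))"
    unfolding sum_distrib_left by (intro sum.cong refl) (simp add: KD mult.assoc del: index_mult_mat)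
  also have "\<dots> = \<kappa> * (?S $$ (r + 1, q) - ?S $$ (r, q))" by (subst diff_mat_sum[OF N(2)]) simp
  finally show ?thesis by (simp add: \<kappa>_def N_def)
qed

text \<open>The bound \<open>u < k\<close> leaves degree at least 1 at every stage, so the
  derivatives exist at the knots too and the induction runs pointwise on the closed
  interval.\<close>

lemma iterated_deriv_spline:
  assumes t: "extended_knots k g a b t" and u: "u < k" and x: "x \<in> {a..b}"
  shows "iterated_deriv {a..b} u (\<lambda>x. \<Sum>r<g + k + 1. \<beta> r * bspline t g k (int r - int k) x) x
    = (\<Sum>r<g + k + 1 - u. (\<Sum>q<g + k + 1. deriv_mat t g k u $$ (r, q) * \<beta> q)
        * bspline t g (k - u) (int r - int k + int u) x)"
  using u x
proof (induction u arbitrary: x)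
  case 0
  have "(\<Sum>q<g + k + 1. 1\<^sub>m (g + k + 1) $$ (r, q) * \<beta> q) = \<beta> r" if "r < g + k + 1" for r
  proof -
    have "(\<Sum>q<g + k + 1. 1\<^sub>m (g + k + 1) $$ (r, q) * \<beta> q) = (\<Sum>q<g + k + 1. if q = r then \<beta> q else 0)"
      using that by (intro sum.cong) auto
    then show ?thesis using that by simp
  qed
  then show ?case by (simp del: sum.lessThan_Suc)
next
  case (Suc u)
  define p where "p = k - Suc u"
  have p: "0 < p" "p < k" "k - u = Suc p" "g + k + 1 - u = g + p + 2" "g + k + 1 - Suc u = g + p + 1"
    "k - Suc u = p" using Suc.prems by (auto simp: p_def)
  have ip: "int r - int k + int u = int r - int (Suc p)" "int r - int k + int (Suc u) = int r - int p" for r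
    using Suc.prems by (auto simp: p_def)
  define \<gamma> where "\<gamma> r = (\<Sum>q<g + k + 1. deriv_mat t g k u $$ (r, q) * \<beta> q)" for r
  define f where "f = (\<lambda>x. \<Sum>r<g + p + 2. \<gamma> r * bspline t g (Suc p) (int r - int (Suc p)) x)"
  define d where "d = (\<Sum>r<g + p + 1. real (p + 1) / (t (int r + 1) - t (int r - int p)) * (\<gamma> (r + 1) - \<gamma> r)
       * bspline t g p (int r - int p) x)"
  have IH: "iterated_deriv {a..b} u (\<lambda>x. \<Sum>r<g + k + 1. \<beta> r * bspline t g k (int r - int k) x) y = f y"
    if "y \<in> {a..b}" for y
    using Suc.IH[OF _ that] Suc.prems(1) unfolding f_def \<gamma>_def p ip by simp
  have "(f has_vector_derivative d) (at x within {a..b})"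
    unfolding f_def d_def by (rule extended_spline_has_vector_derivative[OF t p(1,2) Suc.prems(2)])
  \<comment> \<open>The induction hypothesis describes the previous derivative on
    \<open>{a..b}\<close> only; differentiating within that interval makes this sufficient.\<close>
  then have "(iterated_deriv {a..b} u (\<lambda>x. \<Sum>r<g + k + 1. \<beta> r * bspline t g k (int r - int k) x)
      has_vector_derivative d) (at x within {a..b})"
    by (rule has_vector_derivative_transform[OF Suc.prems(2), rotated]) (rule IH)
  then have "iterated_deriv {a..b} (Suc u) (\<lambda>x. \<Sum>r<g + k + 1. \<beta> r * bspline t g k (int r - int k) x) x = d"
    using extended_knots_less[OF t] Suc.prems(2)
    by (auto intro!: vector_derivative_within_cbox[of a b, unfolded cbox_interval])
  also have "d = (\<Sum>r<g + p + 1. (\<Sum>q<g + k + 1. deriv_mat t g k (Suc u) $$ (r, q) * \<beta> q)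
        * bspline t g p (int r - int p) x)"
    unfolding d_def
  proof (rule sum.cong[OF refl])
    fix r assume "r \<in> {..<g + p + 1}"
    then have r: "r < g + k - u" using p by auto
    have "real (k - u) = real (p + 1)" "int r - int k + int u + 1 = int r - int p"
      using p ip[of r] by auto
    note dm = deriv_mat_Suc_index[OF _ r, unfolded this]
    have "(\<Sum>q<g + k + 1. deriv_mat t g k (Suc u) $$ (r, q) * \<beta> q)
        = real (p + 1) / (t (int r + 1) - t (int r - int p)) * (\<gamma> (r + 1) - \<gamma> r)"
      unfolding \<gamma>_def sum_subtractf[symmetric] sum_distrib_left
      using Suc.prems(1) by (intro sum.cong refl) (simp add: dm algebra_simps del: deriv_mat.simps)
    then show "real (p + 1) / (t (int r + 1) - t (int r - int p)) * (\<gamma> (r + 1) - \<gamma> r) * bspline t g p (int r - int p) x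
        = (\<Sum>q<g + k + 1. deriv_mat t g k (Suc u) $$ (r, q) * \<beta> q) * bspline t g p (int r - int p) x"
      by simp
  qed
  finally show ?case unfolding p ip by simp
qed

section \<open>Tensor product splines\<close>

text \<open>Links positions in \<open>cs\<close> order with index pairs: \<open>p mod N\<close> is
  the row, belonging to x, and \<open>p div N\<close> the column, belonging to y.\<close>

lemma sum_div_mod:
  fixes f :: "nat \<Rightarrow> nat \<Rightarrow> 'a :: comm_monoid_add"
  shows "(\<Sum>p<M * N. f (p div N) (p mod N)) = (\<Sum>j<M. \<Sum>i<N. f j i)"
proof -
  have "(\<Sum>p<M * N. f (p div N) (p mod N)) = (\<Sum>j<M. \<Sum>p\<in>{j * N..<j * N + N}. f (p div N) (p mod N))"
    by (rule sum.nat_group[symmetric])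
  also have "\<dots> = (\<Sum>j<M. \<Sum>i<N. f j i)"
  proof (rule sum.cong[OF refl])
    fix j
    show "(\<Sum>p\<in>{j * N..<j * N + N}. f (p div N) (p mod N)) = (\<Sum>i<N. f j i)"
      by (rule sum.reindex_bij_witness[of _ "\<lambda>i. j * N + i" "\<lambda>p. p - j * N"])
        (auto simp: div_nat_eqI mult.commute[of N] modulo_nat_def)
  qed
  finally show ?thesis .
qed

lemma div_less_of_less_mult: "p < M * N \<Longrightarrow> p div N < (M :: nat)"
  by (simp add: less_mult_imp_div_less)

lemma mod_less_of_less_mult: "p < M * N \<Longrightarrow> p mod N < (N :: nat)"
  by (metis mod_less_divisor mult_0_right not_gr_zero not_less_zero)

lemma kron_carrier:
  "A \<in> carrier_mat m m' \<Longrightarrow> B \<in> carrier_mat n n' \<Longrightarrow> A \<otimes>\<^sub>m B \<in> carrier_mat (m * n) (m' * n')"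
  by (auto simp: kron_def)

lemma kron_mult_vec_index:
  assumes "A \<in> carrier_mat m m'" "B \<in> carrier_mat n n'" "b \<in> carrier_vec (m' * n')" "r < m * n"
  shows "((A \<otimes>\<^sub>m B) *\<^sub>v b) $ r
    = (\<Sum>p<m' * n'. A $$ (r div n, p div n') * B $$ (r mod n, p mod n') * b $ p)"
  using assms by (auto simp: kron_def scalar_prod_def atLeast0LessThan intro!: sum.cong)

text \<open>Coefficients form one vector in \<open>cs\<close> order, so that Kronecker products act
  on them directly; the y factor comes first, as in those products.\<close>

definition tensor_spline ::
  "(int \<Rightarrow> real) \<Rightarrow> nat \<Rightarrow> nat \<Rightarrow> (int \<Rightarrow> real) \<Rightarrow> nat \<Rightarrow> nat \<Rightarrow> real vec \<Rightarrow> real \<Rightarrow> real \<Rightarrow> real" where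
  "tensor_spline lam g k mu h l b x y = (\<Sum>p<(h + l + 1) * (g + k + 1).
     b $ p * (bspline mu h l (int (p div (g + k + 1)) - int l) y
       * bspline lam g k (int (p mod (g + k + 1)) - int k) x))"

lemma bspline_mat_carrier: "bspline_mat t g k xs \<in> carrier_mat (dim_vec xs) (g + k + 1)"
  by (simp add: bspline_mat_def)

lemma bspline_mat_index:
  "r < dim_vec xs \<Longrightarrow> i < g + k + 1 \<Longrightarrow>
    bspline_mat t g k xs $$ (r, i) = bspline t g k (int i - int k) (xs $ r)"
  by (simp add: bspline_mat_def)

lemma collocation_mult_vec_index:
  assumes b: "b \<in> carrier_vec ((h + l + 1) * (g + k + 1))" and r: "r < dim_vec ys * dim_vec xs"
  shows "((bspline_mat mu h l ys \<otimes>\<^sub>m bspline_mat lam g k xs) *\<^sub>v b) $ r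
    = tensor_spline lam g k mu h l b (xs $ (r mod dim_vec xs)) (ys $ (r div dim_vec xs))"
  unfolding kron_mult_vec_index[OF bspline_mat_carrier bspline_mat_carrier b r] tensor_spline_def
  using div_less_of_less_mult[OF r] mod_less_of_less_mult[OF r]
  by (intro sum.cong refl) (auto simp: bspline_mat_index div_less_of_less_mult mod_less_of_less_mult
      simp del: add_Suc_right mult_Suc_right mult_Suc)

lemma collocation_row_mult_vec:
  assumes b: "b \<in> carrier_vec ((h + l + 1) * (g + k + 1))"
  shows "((bspline_row mu h l y \<otimes>\<^sub>m bspline_row lam g k x) *\<^sub>v b) $ 0 = tensor_spline lam g k mu h l b x y"
  unfolding bspline_row_def by (subst collocation_mult_vec_index[OF b]) auto

lemma sum_int_interval_shift: "(\<Sum>i = - int k..int g. f i) = (\<Sum>r<g + k + 1. f (int r - int k))"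
  by (rule sum.reindex_bij_witness[of _ "\<lambda>r. int r - int k" "\<lambda>i. nat (i + int k)"]) auto

lemma tensor_splines_eq:
  "tensor_splines k g lam l h mu =
    tensor_spline lam g k mu h l ` carrier_vec ((h + l + 1) * (g + k + 1))"
proof -
  define N M where "N = g + k + 1" and "M = h + l + 1"
  define f where "f \<beta> = (\<lambda>x y. \<Sum>i = - int k..int g. \<Sum>j = - int l..int h.
           \<beta> i j * bspline lam g k i x * bspline mu h l j y)" for \<beta> :: "int \<Rightarrow> int \<Rightarrow> real"
  define coeffs where "coeffs \<beta> = vec (M * N) (\<lambda>p. \<beta> (int (p mod N) - int k) (int (p div N) - int l))"
    for \<beta> :: "int \<Rightarrow> int \<Rightarrow> real"
  have f: "f \<beta> = tensor_spline lam g k mu h l (coeffs \<beta>)" for \<beta>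
  proof (intro ext)
    fix x y
    let ?F = "\<lambda>j i. \<beta> (int i - int k) (int j - int l) * (bspline mu h l (int j - int l) y
       * bspline lam g k (int i - int k) x)"
    have "f \<beta> x y = (\<Sum>i<N. \<Sum>j<M. ?F j i)"
      unfolding f_def sum_int_interval_shift N_def M_def
      by (intro sum.cong refl) (simp only: mult_ac)
    also have "\<dots> = (\<Sum>j<M. \<Sum>i<N. ?F j i)" by (rule sum.swap)
    also have "\<dots> = (\<Sum>p<M * N. ?F (p div N) (p mod N))" by (rule sum_div_mod[symmetric])
    also have "\<dots> = tensor_spline lam g k mu h l (coeffs \<beta>) x y"
      unfolding tensor_spline_def N_def[symmetric] M_def[symmetric] coeffs_def
      by (intro sum.cong refl) (subst index_vec; simp)
    finally show "f \<beta> x y = tensor_spline lam g k mu h l (coeffs \<beta>) x y" .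
  qed
  have "b \<in> range coeffs" if b: "b \<in> carrier_vec (M * N)" for b
  proof
    show "b = coeffs (\<lambda>i j. b $ (nat (j + int l) * N + nat (i + int k)))"
      using b by (intro eq_vecI) (auto simp: coeffs_def)
  qed simp
  moreover have "coeffs \<beta> \<in> carrier_vec (M * N)" for \<beta> by (simp add: coeffs_def)
  ultimately have "range coeffs = carrier_vec (M * N)" by auto
  moreover have "tensor_splines k g lam l h mu = range f"
    unfolding tensor_splines_def f_def by auto
  ultimately show ?thesis
    unfolding N_def[symmetric] M_def[symmetric] f[abs_def] by (metis image_image)
qed

text \<open>For fixed x this is a univariate spline in y with coefficients depending on x. Its
  \<open>v\<close>-th derivative is then read as a spline in x with coefficients depending on y. The
  rest regroups four nested sums into Kronecker form.\<close>

lemma mixed_deriv_tensor_spline: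
  assumes lam: "extended_knots k g a b lam" and mu: "extended_knots l h c d mu"
    and u: "u < k" and v: "v < l" and x: "x \<in> {a..b}" and y: "y \<in> {c..d}"
    and e: "e \<in> carrier_vec ((h + l + 1) * (g + k + 1))"
  shows "mixed_deriv {a..b} {c..d} u v (tensor_spline lam g k mu h l e) x y =
    (\<Sum>r<(h + l + 1 - v) * (g + k + 1 - u). ((deriv_mat mu h l v \<otimes>\<^sub>m deriv_mat lam g k u) *\<^sub>v e) $ r
      * (bspline mu h (l - v) (int (r div (g + k + 1 - u)) - int l + int v) y
       * bspline lam g (k - u) (int (r mod (g + k + 1 - u)) - int k + int u) x))"
proof -
  define N M N' M' where "N = g + k + 1" and "M = h + l + 1" and "N' = g + k + 1 - u" and "M' = h + l + 1 - v"
  define Bx where "Bx i = bspline lam g k (int i - int k)" for i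
  define By where "By j = bspline mu h l (int j - int l)" for j
  define Cx where "Cx i = bspline lam g (k - u) (int i - int k + int u)" for i
  define Cy where "Cy j = bspline mu h (l - v) (int j - int l + int v)" for j
  define Sx Sy where "Sx = deriv_mat lam g k u" and "Sy = deriv_mat mu h l v"
  define E where "E j i = e $ (j * N + i)" for j i
  have E: "e $ p = E (p div N) (p mod N)" for p by (simp add: E_def)
  have s: "tensor_spline lam g k mu h l e x y = (\<Sum>j<M. (\<Sum>i<N. E j i * Bx i x) * By j y)" for x y
  proof -
    have "tensor_spline lam g k mu h l e x y
        = (\<Sum>p<M * N. E (p div N) (p mod N) * (By (p div N) y * Bx (p mod N) x))"
      unfolding tensor_spline_def N_def[symmetric] M_def[symmetric] Bx_def By_def by (simp only: E)
    also have "\<dots> = (\<Sum>j<M. \<Sum>i<N. E j i * (By j y * Bx i x))" by (rule sum_div_mod)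
    finally show ?thesis by (simp only: sum_distrib_left sum_distrib_right mult_ac)
  qed
  have inner: "(\<Sum>j<M. \<Sum>i<N. Sy $$ (r, j) * Sx $$ (q, i) * E j i)
      = (\<Sum>p<M * N. Sy $$ (r, p div N) * Sx $$ (q, p mod N) * E (p div N) (p mod N))" for r q
    by (rule sum_div_mod[symmetric])
  \<comment> \<open>Valid for every real \<open>x'\<close>, so it can be rewritten under the outer
    derivative.\<close>
  have dy: "iterated_deriv {c..d} v (tensor_spline lam g k mu h l e x') y
      = (\<Sum>i<N. (\<Sum>r<M'. (\<Sum>j<M. Sy $$ (r, j) * E j i) * Cy r y) * Bx i x')" for x'
  proof -
    have "iterated_deriv {c..d} v (tensor_spline lam g k mu h l e x') y
        = (\<Sum>r<M'. (\<Sum>j<M. Sy $$ (r, j) * (\<Sum>i<N. E j i * Bx i x')) * Cy r y)"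
      unfolding s[abs_def] using iterated_deriv_spline[OF mu v y, of "\<lambda>j. \<Sum>i<N. E j i * Bx i x'"]
      unfolding M_def M'_def By_def Cy_def Sy_def by simp
    also have "\<dots> = (\<Sum>r<M'. \<Sum>j<M. \<Sum>i<N. Sy $$ (r, j) * E j i * Cy r y * Bx i x')"
      by (simp only: sum_distrib_left sum_distrib_right mult_ac)
    also have "\<dots> = (\<Sum>r<M'. \<Sum>i<N. \<Sum>j<M. Sy $$ (r, j) * E j i * Cy r y * Bx i x')"
      by (intro sum.cong refl sum.swap)
    also have "\<dots> = (\<Sum>i<N. \<Sum>r<M'. \<Sum>j<M. Sy $$ (r, j) * E j i * Cy r y * Bx i x')"
      by (rule sum.swap)
    finally show ?thesis by (simp only: sum_distrib_left sum_distrib_right mult_ac)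
  qed
  have "mixed_deriv {a..b} {c..d} u v (tensor_spline lam g k mu h l e) x y
      = (\<Sum>q<N'. (\<Sum>i<N. Sx $$ (q, i) * (\<Sum>r<M'. (\<Sum>j<M. Sy $$ (r, j) * E j i) * Cy r y)) * Cx q x)"
    unfolding mixed_deriv_def dy
    using iterated_deriv_spline[OF lam u x, of "\<lambda>i. \<Sum>r<M'. (\<Sum>j<M. Sy $$ (r, j) * E j i) * Cy r y"]
    unfolding N_def N'_def Bx_def Cx_def Sx_def by simp
  also have "\<dots> = (\<Sum>q<N'. \<Sum>i<N. \<Sum>r<M'. \<Sum>j<M. Sx $$ (q, i) * Sy $$ (r, j) * E j i * Cy r y * Cx q x)"
    by (simp only: sum_distrib_left sum_distrib_right mult_ac)
  also have "\<dots> = (\<Sum>q<N'. \<Sum>r<M'. \<Sum>i<N. \<Sum>j<M. Sx $$ (q, i) * Sy $$ (r, j) * E j i * Cy r y * Cx q x)"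
    by (intro sum.cong refl sum.swap)
  also have "\<dots> = (\<Sum>q<N'. \<Sum>r<M'. \<Sum>j<M. \<Sum>i<N. Sx $$ (q, i) * Sy $$ (r, j) * E j i * Cy r y * Cx q x)"
    by (intro sum.cong refl sum.swap)
  also have "\<dots> = (\<Sum>r<M'. \<Sum>q<N'. \<Sum>j<M. \<Sum>i<N. Sx $$ (q, i) * Sy $$ (r, j) * E j i * Cy r y * Cx q x)"
    by (rule sum.swap)
  also have "\<dots> = (\<Sum>r<M'. \<Sum>q<N'. (\<Sum>j<M. \<Sum>i<N. Sy $$ (r, j) * Sx $$ (q, i) * E j i) * (Cy r y * Cx q x))"
    by (simp only: sum_distrib_left sum_distrib_right mult_ac)
  also have "\<dots> = (\<Sum>r<M'. \<Sum>q<N'. (\<Sum>p<M * N. Sy $$ (r, p div N) * Sx $$ (q, p mod N) * E (p div N) (p mod N)) * (Cy r y * Cx q x))"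
    by (simp only: inner)
  also have "\<dots> = (\<Sum>s<M' * N'. (\<Sum>p<M * N. Sy $$ (s div N', p div N) * Sx $$ (s mod N', p mod N) * E (p div N) (p mod N))
      * (Cy (s div N') y * Cx (s mod N') x))"
    by (rule sum_div_mod[symmetric])
  also have "\<dots> = (\<Sum>s<M' * N'. ((Sy \<otimes>\<^sub>m Sx) *\<^sub>v e) $ s * (Cy (s div N') y * Cx (s mod N') x))"
  proof (intro sum.cong refl)
    fix s assume "s \<in> {..<M' * N'}"
    have "Sy \<in> carrier_mat M' M" "Sx \<in> carrier_mat N' N"
      using deriv_mat_carrier[of v l mu h] deriv_mat_carrier[of u k lam g] u v
      unfolding Sx_def Sy_def N_def M_def N'_def M'_def by simp_all
    from kron_mult_vec_index[OF this e[folded N_def M_def]] \<open>s \<in> _\<close>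
    have "((Sy \<otimes>\<^sub>m Sx) *\<^sub>v e) $ s = (\<Sum>p<M * N. Sy $$ (s div N', p div N) * Sx $$ (s mod N', p mod N) * E (p div N) (p mod N))"
      by (simp only: E lessThan_iff)
    then show "(\<Sum>p<M * N. Sy $$ (s div N', p div N) * Sx $$ (s mod N', p mod N) * E (p div N) (p mod N))
      * (Cy (s div N') y * Cx (s mod N') x) = ((Sy \<otimes>\<^sub>m Sx) *\<^sub>v e) $ s * (Cy (s div N') y * Cx (s mod N') x)"
      by (simp only:)
  qed
  finally show ?thesis
    unfolding Sx_def Sy_def Cx_def Cy_def N'_def M'_def .
qed

section \<open>Integrals over the rectangle and the quadratic functional\<close>

lemma has_integral_tensor_product:
  fixes f g :: "real \<Rightarrow> real"
  assumes f: "continuous_on {a..b} f" and g: "continuous_on {c..d} g"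
  shows "((\<lambda>(x, y). g y * f x) has_integral (integral {c..d} g * integral {a..b} f)) ({a..b} \<times> {c..d})"
proof -
  have box: "{a..b} \<times> {c..d} = cbox (a, c) (b, d)" by (simp add: cbox_Pair_eq)
  have cont: "continuous_on (cbox (a, c) (b, d)) (\<lambda>(x, y). g y * f x)"
    unfolding box[symmetric] split_beta
    by (intro continuous_intros continuous_on_compose2[OF f] continuous_on_compose2[OF g]) auto
  have "integral (cbox (a, c) (b, d)) (\<lambda>(x, y). g y * f x)
      = integral (cbox a b) (\<lambda>x. integral (cbox c d) (\<lambda>y. g y * f x))"
    using integral_prod_continuous[OF cont] by simp
  also have "\<dots> = integral {c..d} g * integral {a..b} f"
    by (simp add: cbox_interval integral_mult_left integral_mult_right)
  finally show ?thesis
    unfolding box using integrable_continuous[OF cont] by (simp add: has_integral_integral)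
qed

lemma has_integral_tensor_sum:
  fixes f g :: "nat \<Rightarrow> real \<Rightarrow> real"
  assumes f: "\<And>i. i < N \<Longrightarrow> continuous_on {a..b} (f i)" and g: "\<And>j. j < M \<Longrightarrow> continuous_on {c..d} (g j)"
  shows "((\<lambda>(x, y). \<Sum>r<M * N. e r * (g (r div N) y * f (r mod N) x)) has_integral
    (\<Sum>r<M * N. e r * (integral {c..d} (g (r div N)) * integral {a..b} (f (r mod N))))) ({a..b} \<times> {c..d})"
proof -
  have "((\<lambda>z. \<Sum>r<M * N. e r * (\<lambda>(x, y). g (r div N) y * f (r mod N) x) z) has_integral
    (\<Sum>r<M * N. e r * (integral {c..d} (g (r div N)) * integral {a..b} (f (r mod N))))) ({a..b} \<times> {c..d})"
    by (rule has_integral_sum[OF finite_lessThan], rule has_integral_mult_right,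
        rule has_integral_tensor_product)
      (auto intro!: f g simp: div_less_of_less_mult mod_less_of_less_mult)
  then show ?thesis by (simp add: case_prod_beta')
qed

lemma has_integral_tensor_sum_square:
  fixes f g :: "nat \<Rightarrow> real \<Rightarrow> real"
  assumes f: "\<And>i. i < N \<Longrightarrow> continuous_on {a..b} (f i)" and g: "\<And>j. j < M \<Longrightarrow> continuous_on {c..d} (g j)"
  shows "((\<lambda>(x, y). (\<Sum>r<M * N. e r * (g (r div N) y * f (r mod N) x))\<^sup>2) has_integral
    (\<Sum>r<M * N. \<Sum>q<M * N. e r * e q * (integral {c..d} (\<lambda>y. g (r div N) y * g (q div N) y)
       * integral {a..b} (\<lambda>x. f (r mod N) x * f (q mod N) x)))) ({a..b} \<times> {c..d})"
proof -
  have "((\<lambda>z. \<Sum>r<M * N. \<Sum>q<M * N. e r * e q * (\<lambda>(x, y). (g (r div N) y * g (q div N) y)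
       * (f (r mod N) x * f (q mod N) x)) z) has_integral
    (\<Sum>r<M * N. \<Sum>q<M * N. e r * e q * (integral {c..d} (\<lambda>y. g (r div N) y * g (q div N) y)
       * integral {a..b} (\<lambda>x. f (r mod N) x * f (q mod N) x)))) ({a..b} \<times> {c..d})"
    by (rule has_integral_sum[OF finite_lessThan], rule has_integral_sum[OF finite_lessThan],
        rule has_integral_mult_right, rule has_integral_tensor_product)
      (auto intro!: continuous_on_mult f g simp: div_less_of_less_mult mod_less_of_less_mult)
  moreover have "(\<Sum>r<M * N. \<Sum>q<M * N. e r * e q * (\<lambda>(x, y). (g (r div N) y * g (q div N) y)
       * (f (r mod N) x * f (q mod N) x)) z)
      = (\<lambda>(x, y). (\<Sum>r<M * N. e r * (g (r div N) y * f (r mod N) x))\<^sup>2) z" for z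
    unfolding power2_eq_square split_beta sum_product by (intro sum.cong refl) (simp only: mult_ac)
  ultimately show ?thesis by (simp only:)
qed


lemma gram_mat_carrier: "gram_mat t g k u \<in> carrier_mat (g + k + 1 - u) (g + k + 1 - u)"
  by (simp add: gram_mat_def)

lemma kron_transpose:
  assumes "A \<in> carrier_mat m m'" "B \<in> carrier_mat n n'"
  shows "(A \<otimes>\<^sub>m B)\<^sup>T = A\<^sup>T \<otimes>\<^sub>m B\<^sup>T"
  using assms by (intro eq_matI)
    (auto simp: kron_def div_less_of_less_mult mod_less_of_less_mult)

lemma gram_mat_transpose: "(gram_mat t g k u)\<^sup>T = gram_mat t g k u"
  by (intro eq_matI) (auto simp: gram_mat_def mult.commute)

text \<open>Phrased with \<open>has_integral\<close>, it provides the value of the energy term and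
  also, as the integral of a square, the positive semidefiniteness of the Gram matrix.\<close>

lemma has_integral_gram_form:
  assumes lam: "extended_knots k g a b lam" and mu: "extended_knots l h c d mu"
    and u: "u < k" and v: "v < l"
    and e: "e \<in> carrier_vec ((h + l + 1 - v) * (g + k + 1 - u))"
  shows "((\<lambda>(x, y). (\<Sum>r<(h + l + 1 - v) * (g + k + 1 - u). e $ r
      * (bspline mu h (l - v) (int (r div (g + k + 1 - u)) - int l + int v) y
       * bspline lam g (k - u) (int (r mod (g + k + 1 - u)) - int k + int u) x))\<^sup>2)
    has_integral e \<bullet> ((gram_mat mu h l v \<otimes>\<^sub>m gram_mat lam g k u) *\<^sub>v e)) ({a..b} \<times> {c..d})"
proof -
  define N M where "N = g + k + 1 - u" and "M = h + l + 1 - v"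
  define Cx where "Cx i = bspline lam g (k - u) (int i - int k + int u)" for i
  define Cy where "Cy j = bspline mu h (l - v) (int j - int l + int v)" for j
  have e: "e \<in> carrier_vec (M * N)" using e by (simp only: N_def M_def)
  have Cx: "continuous_on {a..b} (Cx i)" if "i < N" for i
  proof -
    have "int i - int k + int u = int i - int (k - u)" using u by simp
    then show ?thesis unfolding Cx_def
      by (simp only:) (rule extended_bspline_continuous[OF lam]; use u that in \<open>simp add: N_def\<close>)
  qed
  have Cy: "continuous_on {c..d} (Cy j)" if "j < M" for j
  proof -
    have "int j - int l + int v = int j - int (l - v)" using v by simp
    then show ?thesis unfolding Cy_def
      by (simp only:) (rule extended_bspline_continuous[OF mu]; use v that in \<open>simp add: M_def\<close>)
  qed
  have ends: "lam 0 = a" "lam (int g + 1) = b" "mu 0 = c" "mu (int h + 1) = d"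
    using lam mu by (auto simp: extended_knots_def)
  let ?G = "gram_mat mu h l v" and ?H = "gram_mat lam g k u"
  have G: "?G \<in> carrier_mat M M" and H: "?H \<in> carrier_mat N N"
    using gram_mat_carrier unfolding N_def M_def by auto
  have G_index: "?G $$ (i, j) = integral {c..d} (\<lambda>y. Cy i y * Cy j y)" if "i < M" "j < M" for i j
    using that by (simp add: gram_mat_def M_def Cy_def ends)
  have H_index: "?H $$ (i, j) = integral {a..b} (\<lambda>x. Cx i x * Cx j x)" if "i < N" "j < N" for i j
    using that by (simp add: gram_mat_def N_def Cx_def ends)
  have "e \<bullet> ((?G \<otimes>\<^sub>m ?H) *\<^sub>v e) = (\<Sum>r<M * N. e $ r * ((?G \<otimes>\<^sub>m ?H) *\<^sub>v e) $ r)"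
    using carrier_matD[OF kron_carrier[OF G H]] unfolding scalar_prod_def
    by (simp add: atLeast0LessThan del: index_mult_mat_vec)
  also have "\<dots> = (\<Sum>r<M * N. \<Sum>q<M * N. e $ r * e $ q * (integral {c..d} (\<lambda>y. Cy (r div N) y * Cy (q div N) y)
       * integral {a..b} (\<lambda>x. Cx (r mod N) x * Cx (q mod N) x)))"
  proof (rule sum.cong[OF refl])
    fix r assume r: "r \<in> {..<M * N}"
    have "((?G \<otimes>\<^sub>m ?H) *\<^sub>v e) $ r
        = (\<Sum>q<M * N. ?G $$ (r div N, q div N) * ?H $$ (r mod N, q mod N) * e $ q)"
      using r by (intro kron_mult_vec_index[OF G H e]) simp
    also have "\<dots> = (\<Sum>q<M * N. e $ q * (integral {c..d} (\<lambda>y. Cy (r div N) y * Cy (q div N) y)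
       * integral {a..b} (\<lambda>x. Cx (r mod N) x * Cx (q mod N) x)))"
      using r by (intro sum.cong refl)
        (simp add: G_index H_index div_less_of_less_mult mod_less_of_less_mult)
    finally show "e $ r * ((?G \<otimes>\<^sub>m ?H) *\<^sub>v e) $ r
      = (\<Sum>q<M * N. e $ r * e $ q * (integral {c..d} (\<lambda>y. Cy (r div N) y * Cy (q div N) y)
       * integral {a..b} (\<lambda>x. Cx (r mod N) x * Cx (q mod N) x)))"
      by (simp only: sum_distrib_left mult.assoc)
  qed
  finally show ?thesis
    using has_integral_tensor_sum_square[where N = N and M = M and f = Cx and g = Cy, OF Cx Cy, where e = "\<lambda>r. e $ r"]
    unfolding Cx_def Cy_def N_def M_def by (simp only:)
qed

lemma smoothing_functional_tensor_spline:
  assumes lam: "extended_knots k g a b lam" and mu: "extended_knots l h c d mu"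
    and u: "u < k" and v: "v < l"
    and F: "F \<in> carrier_mat (dim_vec xs) (dim_vec ys)"
    and e: "e \<in> carrier_vec ((h + l + 1) * (g + k + 1))"
  defines "BB \<equiv> bspline_mat mu h l ys \<otimes>\<^sub>m bspline_mat lam g k xs"
    and "SS \<equiv> deriv_mat mu h l v \<otimes>\<^sub>m deriv_mat lam g k u"
    and "MM \<equiv> gram_mat mu h l v \<otimes>\<^sub>m gram_mat lam g k u"
  shows "smoothing_functional a b c d u v \<alpha> xs ys F (tensor_spline lam g k mu h l e)
    = \<alpha> * ((cs F - BB *\<^sub>v e) \<bullet> (cs F - BB *\<^sub>v e)) + (1 - \<alpha>) * ((SS *\<^sub>v e) \<bullet> (MM *\<^sub>v (SS *\<^sub>v e)))"
proof -
  define n m where "n = dim_vec xs" and "m = dim_vec ys"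
  let ?s = "tensor_spline lam g k mu h l e"
  \<comment> \<open>The y sum has to be the outer one, since \<open>cs\<close> stacks the columns of
    \<open>F\<close>.\<close>
  have "(\<Sum>i<n. \<Sum>j<m. (F $$ (i, j) - ?s (xs $ i) (ys $ j))\<^sup>2)
      = (\<Sum>j<m. \<Sum>i<n. (F $$ (i, j) - ?s (xs $ i) (ys $ j))\<^sup>2)"
    by (rule sum.swap)
  also have "\<dots> = (\<Sum>p<m * n. (F $$ (p mod n, p div n) - ?s (xs $ (p mod n)) (ys $ (p div n)))\<^sup>2)"
    by (rule sum_div_mod[symmetric])
  also have "\<dots> = (\<Sum>p<m * n. (cs F - BB *\<^sub>v e) $ p * (cs F - BB *\<^sub>v e) $ p)"
  proof (rule sum.cong[OF refl])
    fix p assume "p \<in> {..<m * n}"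
    then have p: "p < m * n" by simp
    have "(BB *\<^sub>v e) $ p = ?s (xs $ (p mod n)) (ys $ (p div n))"
      unfolding BB_def n_def by (rule collocation_mult_vec_index[OF e p[unfolded n_def m_def]])
    moreover have "cs F $ p = F $$ (p mod n, p div n)"
      using F p by (simp add: cs_def n_def m_def mult.commute)
    moreover have "dim_row BB = m * n" by (simp add: BB_def kron_def bspline_mat_def n_def m_def)
    ultimately show "(F $$ (p mod n, p div n) - ?s (xs $ (p mod n)) (ys $ (p div n)))\<^sup>2
        = (cs F - BB *\<^sub>v e) $ p * (cs F - BB *\<^sub>v e) $ p"
      using p by (simp add: power2_eq_square del: index_mult_mat_vec)
  qed
  also have "\<dots> = (cs F - BB *\<^sub>v e) \<bullet> (cs F - BB *\<^sub>v e)"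
    unfolding scalar_prod_def
    by (simp add: BB_def kron_def bspline_mat_def n_def m_def atLeast0LessThan)
  finally have data: "(\<Sum>i<n. \<Sum>j<m. (F $$ (i, j) - ?s (xs $ i) (ys $ j))\<^sup>2)
      = (cs F - BB *\<^sub>v e) \<bullet> (cs F - BB *\<^sub>v e)" .
  have "SS \<in> carrier_mat ((h + l + 1 - v) * (g + k + 1 - u)) ((h + l + 1) * (g + k + 1))"
    unfolding SS_def using u v by (intro kron_carrier deriv_mat_carrier) auto
  then have "SS *\<^sub>v e \<in> carrier_vec ((h + l + 1 - v) * (g + k + 1 - u))" using e by (rule mult_mat_vec_carrier)
  note energy = has_integral_gram_form[OF lam mu u v this, folded MM_def]
  \<comment> \<open>The derivative formula is available on the rectangle, which is all that the
    integral sees.\<close>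
  have "((\<lambda>(x, y). (mixed_deriv {a..b} {c..d} u v ?s x y)\<^sup>2) has_integral
      (SS *\<^sub>v e) \<bullet> (MM *\<^sub>v (SS *\<^sub>v e))) ({a..b} \<times> {c..d})"
    by (rule has_integral_eq[OF _ energy])
      (auto simp: mixed_deriv_tensor_spline[OF lam mu u v _ _ e] SS_def simp del: index_mult_mat_vec)
  from integral_unique[OF this] show ?thesis
    unfolding smoothing_functional_def by (simp only: data[unfolded n_def m_def])
qed

lemma gram_form_nonneg:
  assumes "extended_knots k g a b lam" "extended_knots l h c d mu" "u < k" "v < l"
    and "e \<in> carrier_vec ((h + l + 1 - v) * (g + k + 1 - u))"
  shows "0 \<le> e \<bullet> ((gram_mat mu h l v \<otimes>\<^sub>m gram_mat lam g k u) *\<^sub>v e)"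
  by (rule has_integral_nonneg[OF has_integral_gram_form[OF assms]]) auto

section \<open>Scaling coefficients by the integrals of the B-splines\<close>

lemma knot_diag_kron_mult_vec:
  assumes lam: "extended_knots k g a b lam" and mu: "extended_knots l h c d mu"
    and w: "w \<in> carrier_vec ((h + l + 1) * (g + k + 1))" and p: "p < (h + l + 1) * (g + k + 1)"
  defines "j \<equiv> p div (g + k + 1)" and "i \<equiv> p mod (g + k + 1)"
  shows "((knot_diag mu h l 0 \<otimes>\<^sub>m knot_diag lam g k 0) *\<^sub>v w) $ p
    = real (l + 1) / (mu (int j + 1) - mu (int j - int l)) * (real (k + 1) / (lam (int i + 1) - lam (int i - int k))) * w $ p"
proof -
  define N M where "N = g + k + 1" and "M = h + l + 1"
  let ?Y = "knot_diag mu h l 0" and ?X = "knot_diag lam g k 0"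
  have Y: "?Y \<in> carrier_mat M M" and X: "?X \<in> carrier_mat N N"
    using knot_diag_carrier[of mu h l 0] knot_diag_carrier[of lam g k 0] by (auto simp: N_def M_def)
  have p: "p < M * N" using p by (simp only: N_def M_def)
  have ji: "j = p div N" "i = p mod N" "j < M" "i < N"
    using div_less_of_less_mult[OF p] mod_less_of_less_mult[OF p] by (auto simp: j_def i_def N_def)
  define D where "D = real (l + 1) / (mu (int j + 1) - mu (int j - int l)) * (real (k + 1) / (lam (int i + 1) - lam (int i - int k)))"
  have "((?Y \<otimes>\<^sub>m ?X) *\<^sub>v w) $ p = (\<Sum>q<M * N. ?Y $$ (j, q div N) * ?X $$ (i, q mod N) * w $ q)"
    unfolding ji(1,2) using w p by (intro kron_mult_vec_index[OF Y X]) (auto simp: N_def M_def)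
  also have "\<dots> = (\<Sum>q<M * N. if q = p then D * w $ p else 0)"
  proof (rule sum.cong[OF refl])
    fix q assume "q \<in> {..<M * N}"
    then have q: "q div N < M" "q mod N < N" by (auto simp: div_less_of_less_mult mod_less_of_less_mult)
    \<comment> \<open>Quotient and remainder determine \<open>q\<close>, so the two diagonal
      conditions together single out the entry \<open>p\<close>.\<close>
    have "q = p \<longleftrightarrow> j = q div N \<and> i = q mod N"
      unfolding ji(1,2) by (metis div_mult_mod_eq)
    then show "?Y $$ (j, q div N) * ?X $$ (i, q mod N) * w $ q = (if q = p then D * w $ p else 0)"
      using q ji(3,4) by (subst (1 2) knot_diag_index) (auto simp: N_def M_def D_def)
  qed
  also have "\<dots> = D * w $ p" using p by simp
  finally show ?thesis by (simp only: D_def)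
qed

text \<open>The factors of the diagonal matrix are the reciprocals of the integrals of the B-splines.\<close>

lemma has_integral_tensor_spline_scaled:
  assumes lam: "extended_knots k g a b lam" and mu: "extended_knots l h c d mu"
    and k: "0 < k" and l: "0 < l" and w: "w \<in> carrier_vec ((h + l + 1) * (g + k + 1))"
  shows "((\<lambda>(x, y). tensor_spline lam g k mu h l
      ((knot_diag mu h l 0 \<otimes>\<^sub>m knot_diag lam g k 0) *\<^sub>v w) x y) has_integral
    (\<Sum>p<(h + l + 1) * (g + k + 1). w $ p)) ({a..b} \<times> {c..d})"
proof -
  define N M where "N = g + k + 1" and "M = h + l + 1"
  let ?D = "knot_diag mu h l 0 \<otimes>\<^sub>m knot_diag lam g k 0"
  define Bx where "Bx i = bspline lam g k (int i - int k)" for i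
  define By where "By j = bspline mu h l (int j - int l)" for j
  have Bx: "continuous_on {a..b} (Bx i)" "integral {a..b} (Bx i) = (lam (int i + 1) - lam (int i - int k)) / real (k + 1)"
    "lam (int i - int k) < lam (int i + 1)" if "i < N" for i
    using extended_bspline_continuous[OF lam k order_refl, of i] integral_unique[OF extended_bspline_has_integral[OF lam k, of i]]
      extended_knots_support_less[OF lam, of i] that by (simp_all add: Bx_def N_def)
  have By: "continuous_on {c..d} (By j)" "integral {c..d} (By j) = (mu (int j + 1) - mu (int j - int l)) / real (l + 1)"
    "mu (int j - int l) < mu (int j + 1)" if "j < M" for j
    using extended_bspline_continuous[OF mu l order_refl, of j] integral_unique[OF extended_bspline_has_integral[OF mu l, of j]]
      extended_knots_support_less[OF mu, of j] that by (simp_all add: By_def M_def)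
  have "(\<Sum>p<M * N. (?D *\<^sub>v w) $ p * (integral {c..d} (By (p div N)) * integral {a..b} (Bx (p mod N))))
      = (\<Sum>p<M * N. w $ p)"
  proof (rule sum.cong[OF refl])
    fix p assume "p \<in> {..<M * N}"
    then have p: "p < M * N" by simp
    note ji = div_less_of_less_mult[OF p] mod_less_of_less_mult[OF p]
    show "(?D *\<^sub>v w) $ p * (integral {c..d} (By (p div N)) * integral {a..b} (Bx (p mod N))) = w $ p"
      unfolding knot_diag_kron_mult_vec[OF lam mu w p[unfolded N_def M_def], folded N_def]
        Bx(2)[OF ji(2)] By(2)[OF ji(1)]
      using Bx(3)[OF ji(2)] By(3)[OF ji(1)] by simp
  qed
  with has_integral_tensor_sum[where N = N and M = M and f = Bx and g = By, OF Bx(1) By(1), where e = "\<lambda>p. (?D *\<^sub>v w) $ p"]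
  show ?thesis
    unfolding tensor_spline_def N_def[symmetric] M_def[symmetric] Bx_def By_def by simp
qed

text \<open>Every B-spline in range has a support of positive length, even where boundary knots
  coincide, so the diagonal can be inverted entry by entry.\<close>

lemma knot_diag_kron_surj:
  assumes lam: "extended_knots k g a b lam" and mu: "extended_knots l h c d mu"
    and e: "e \<in> carrier_vec ((h + l + 1) * (g + k + 1))"
  obtains w where "w \<in> carrier_vec ((h + l + 1) * (g + k + 1))"
    "(knot_diag mu h l 0 \<otimes>\<^sub>m knot_diag lam g k 0) *\<^sub>v w = e"
proof
  define N M where "N = g + k + 1" and "M = h + l + 1"
  let ?D = "knot_diag mu h l 0 \<otimes>\<^sub>m knot_diag lam g k 0"
  define w where "w = vec (M * N) (\<lambda>p. e $ p * ((mu (int (p div N) + 1) - mu (int (p div N) - int l)) / real (l + 1)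
     * ((lam (int (p mod N) + 1) - lam (int (p mod N) - int k)) / real (k + 1))))"
  show w: "w \<in> carrier_vec ((h + l + 1) * (g + k + 1))" by (simp add: w_def N_def M_def)
  show "?D *\<^sub>v w = e"
  proof (rule eq_vecI)
    fix p assume "p < dim_vec e"
    then have p: "p < M * N" using e by (simp add: N_def M_def)
    note ji = div_less_of_less_mult[OF p] mod_less_of_less_mult[OF p]
    show "(?D *\<^sub>v w) $ p = e $ p"
      unfolding knot_diag_kron_mult_vec[OF lam mu w p[unfolded N_def M_def], folded N_def]
      using extended_knots_support_less[OF lam ji(2)[unfolded N_def], folded N_def]
        extended_knots_support_less[OF mu ji(1)[unfolded M_def]] p
      by (simp add: w_def N_def[symmetric] M_def[symmetric])
  qed (use e in \<open>simp add: kron_def knot_diag_def mat_diag_def\<close>)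
qed

section \<open>The zero-integral constraint\<close>

text \<open>The bounds on \<open>p\<close> and \<open>q\<close> make the three corner positions
  distinct and nonzero, so that the case distinction in \<open>reduce_constraint\<close> acts as
  three separate column updates.\<close>

lemma reduce_constraint_mult_vec:
  assumes K: "K \<in> carrier_mat m (p * q)" and p: "2 \<le> p" and q: "2 \<le> q"
    and C0: "C 0 = C ((q - 1) * p) + C (p - 1) - C (p * q - 1)"
  shows "reduce_constraint p q K *\<^sub>v vec (p * q - 1) (\<lambda>j. C (j + 1)) = K *\<^sub>v vec (p * q) C"
proof (rule eq_vecI)
  fix i assume "i < dim_vec (K *\<^sub>v vec (p * q) C)"
  then have i: "i < m" using K by simp
  define L where "L = p * q - 1"
  have pq: "p + p \<le> p * q" using q mult_le_mono2[of 2 q p] by (simp add: mult_2_right)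
  then have L: "p * q = Suc L" using p by (simp add: L_def)
  have "(q - 1) * p = p * q - p"
    using diff_mult_distrib[of q 1 p] by (simp add: mult.commute)
  then have pos: "0 < (q - 1) * p" "(q - 1) * p \<le> L" "0 < p - 1" "p - 1 \<le> L" "0 < L"
    "(q - 1) * p \<noteq> p - 1" "(q - 1) * p \<noteq> L" "p - 1 \<noteq> L"
    using pq p L by auto
  have C: "C 0 = C ((q - 1) * p) + C (p - 1) - C L" using C0 by (simp add: L_def)
  have delta: "(\<Sum>j<L. if j + 1 = s then C (j + 1) else 0) = C s" if "0 < s" "s \<le> L" for s
  proof -
    have "(\<Sum>j<L. if j + 1 = s then C (j + 1) else 0) = (\<Sum>j<L. if j = s - 1 then C s else 0)"
      using that by (intro sum.cong) auto
    then show ?thesis using that by simp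
  qed
  have "(reduce_constraint p q K *\<^sub>v vec (p * q - 1) (\<lambda>j. C (j + 1))) $ i
      = (\<Sum>j<L. reduce_constraint p q K $$ (i, j) * C (j + 1))"
    using i K by (simp add: scalar_prod_def reduce_constraint_def atLeast0LessThan L_def)
  also have "\<dots> = (\<Sum>j<L. K $$ (i, j + 1) * C (j + 1) + K $$ (i, 0) *
      ((if j + 1 = (q - 1) * p then C (j + 1) else 0) + (if j + 1 = p - 1 then C (j + 1) else 0)
        - (if j + 1 = L then C (j + 1) else 0)))"
    using i K pos by (intro sum.cong refl) (simp add: reduce_constraint_def L algebra_simps)
  \<comment> \<open>By the constraint, the three corner contributions add up to the term of the
    deleted column.\<close>
  also have "\<dots> = (\<Sum>j<L. K $$ (i, j + 1) * C (j + 1)) + K $$ (i, 0) * C 0"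
    unfolding sum.distrib sum_distrib_left[symmetric] sum_subtractf C
    using delta[OF pos(1,2)] delta[OF pos(3,4)] delta[OF pos(5) order_refl] by simp
  also have "\<dots> = (\<Sum>j<p * q. K $$ (i, j) * C j)"
    unfolding L by (subst sum.lessThan_Suc_shift) simp
  also have "\<dots> = (K *\<^sub>v vec (p * q) C) $ i"
    using i K by (simp add: scalar_prod_def atLeast0LessThan)
  finally show "(reduce_constraint p q K *\<^sub>v vec (p * q - 1) (\<lambda>j. C (j + 1))) $ i
      = (K *\<^sub>v vec (p * q) C) $ i" .
qed (use K in \<open>simp add: reduce_constraint_def\<close>)

lemma diff_kron_mult_vec:
  assumes i: "i < M * N"
  shows "((diff_mat M \<otimes>\<^sub>m diff_mat N) *\<^sub>v vec ((M + 1) * (N + 1)) (\<lambda>j. c (j div (N + 1)) (j mod (N + 1)))) $ i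
    = (c (i div N + 1) (i mod N + 1) - c (i div N + 1) (i mod N))
      - (c (i div N) (i mod N + 1) - c (i div N) (i mod N))"
proof -
  note ji = div_less_of_less_mult[OF i] mod_less_of_less_mult[OF i]
  let ?f = "\<lambda>s r. diff_mat M $$ (i div N, s) * diff_mat N $$ (i mod N, r) * c s r"
  have "((diff_mat M \<otimes>\<^sub>m diff_mat N) *\<^sub>v vec ((M + 1) * (N + 1)) (\<lambda>j. c (j div (N + 1)) (j mod (N + 1)))) $ i
      = (\<Sum>j<(M + 1) * (N + 1). ?f (j div (N + 1)) (j mod (N + 1)))"
    by (subst kron_mult_vec_index[OF diff_mat_carrier diff_mat_carrier _ i])
      (auto intro!: sum.cong)
  also have "\<dots> = (\<Sum>s<M + 1. \<Sum>r<N + 1. ?f s r)" by (rule sum_div_mod)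
  also have "\<dots> = (\<Sum>s<M + 1. diff_mat M $$ (i div N, s) * (\<Sum>r<N + 1. diff_mat N $$ (i mod N, r) * c s r))"
    by (simp only: sum_distrib_left mult.assoc)
  also have "\<dots> = (c (i div N + 1) (i mod N + 1) - c (i div N + 1) (i mod N))
      - (c (i div N) (i mod N + 1) - c (i div N) (i mod N))"
    by (simp only: diff_mat_sum[OF ji(1)] diff_mat_sum[OF ji(2)])
  finally show ?thesis .
qed

text \<open>Second mixed differences telescope, so their sum is the expression in the four corner
  coefficients that the constraint sets to 0; conversely, double partial sums of a vector with sum 0
  satisfy the constraint, because they vanish on two sides of the grid.\<close>

lemma reduced_diff_kron_sum:
  fixes M N :: nat
  assumes M: "0 < M" and N: "0 < N" and z: "z \<in> carrier_vec ((N + 1) * (M + 1) - 1)"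
  defines "Kt \<equiv> reduce_constraint (N + 1) (M + 1) (diff_mat M \<otimes>\<^sub>m diff_mat N)"
  shows "(\<Sum>i<M * N. (Kt *\<^sub>v z) $ i) = 0"
proof -
  let ?p = "N + 1" and ?q = "M + 1"
  \<comment> \<open>The eliminated entry is restored from the constraint. The positions are those of
    the other three corners lowered by one, since \<open>z\<close> starts at entry 1 of the
    grid.\<close>
  define C where "C j = (if j = 0 then z $ (M * ?p - 1) + z $ (N - 1) - z $ (?p * ?q - 2) else z $ (j - 1))" for j
  define c where "c s r = C (s * ?p + r)" for s r
  have corner: "?p * ?q - 1 = M * ?p + N" by (simp add: algebra_simps)
  have "C 0 = C (M * ?p) + C N - C (M * ?p + N)"
    using M N by (simp add: C_def algebra_simps)
  then have C0: "C 0 = C ((?q - 1) * ?p) + C (?p - 1) - C (?p * ?q - 1)"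
    unfolding corner by simp
  have z_eq: "z = vec (?p * ?q - 1) (\<lambda>j. C (j + 1))"
    using z by (intro eq_vecI) (auto simp: C_def)
  have C_eq: "vec (?p * ?q) C = vec (?q * ?p) (\<lambda>j. c (j div ?p) (j mod ?p))"
    unfolding c_def div_mult_mod_eq by (simp only: mult.commute[of ?p ?q])
  have K: "diff_mat M \<otimes>\<^sub>m diff_mat N \<in> carrier_mat (M * N) (?p * ?q)"
    using kron_carrier[OF diff_mat_carrier diff_mat_carrier, of M N] by (simp only: mult.commute[of ?p ?q])
  have Kt_z: "Kt *\<^sub>v z = (diff_mat M \<otimes>\<^sub>m diff_mat N) *\<^sub>v vec (?q * ?p) (\<lambda>j. c (j div ?p) (j mod ?p))"
    unfolding Kt_def z_eq C_eq[symmetric]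
    using M N C0 by (intro reduce_constraint_mult_vec[OF K]) auto
  \<comment> \<open>Once the inner sums over \<open>r\<close> have telescoped, what remains
    telescopes in \<open>s\<close>.\<close>
  have outer: "(\<Sum>s<n. (c (s + 1) N - c (s + 1) 0) - (c s N - c s 0)) = (c n N - c n 0) - (c 0 N - c 0 0)" for n
    by (induction n) simp_all
  from Kt_z have "(\<Sum>i<M * N. (Kt *\<^sub>v z) $ i) = (\<Sum>i<M * N. (c (i div N + 1) (i mod N + 1) - c (i div N + 1) (i mod N))
      - (c (i div N) (i mod N + 1) - c (i div N) (i mod N)))"
    by (intro sum.cong refl) (simp only: lessThan_iff diff_kron_mult_vec)
  also have "\<dots> = (\<Sum>s<M. \<Sum>r<N. (c (s + 1) (r + 1) - c (s + 1) r) - (c s (r + 1) - c s r))"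
    by (rule sum_div_mod)
  also have "\<dots> = (\<Sum>s<M. (c (s + 1) N - c (s + 1) 0) - (c s N - c s 0))"
  proof (rule sum.cong[OF refl])
    show "(\<Sum>r<n. (c (s + 1) (r + 1) - c (s + 1) r) - (c s (r + 1) - c s r))
        = (c (s + 1) n - c (s + 1) 0) - (c s n - c s 0)" for s n
      by (induction n) simp_all
  qed
  also have "\<dots> = (c M N - c M 0) - (c 0 N - c 0 0)"
    by (rule outer)
  also have "\<dots> = 0" using C0 unfolding corner by (simp add: c_def)
  finally show ?thesis .
qed

lemma reduced_diff_kron_surj:
  fixes M N :: nat
  assumes M: "0 < M" and N: "0 < N" and w: "w \<in> carrier_vec (M * N)" and sum: "(\<Sum>i<M * N. w $ i) = 0"
  defines "Kt \<equiv> reduce_constraint (N + 1) (M + 1) (diff_mat M \<otimes>\<^sub>m diff_mat N)"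
  obtains z where "z \<in> carrier_vec ((N + 1) * (M + 1) - 1)" "Kt *\<^sub>v z = w"
proof
  let ?p = "N + 1" and ?q = "M + 1"
  \<comment> \<open>Summation in both directions inverts the mixed difference. The value is 0 when
    either index is 0, and at the opposite corner \<open>(M, N)\<close> it is the total sum of
    \<open>w\<close>.\<close>
  define c where "c s r = (\<Sum>s'<s. \<Sum>r'<r. w $ (s' * N + r'))" for s r
  define C where "C j = c (j div ?p) (j mod ?p)" for j
  have corner: "?p * ?q - 1 = M * ?p + N" by (simp add: algebra_simps)
  have at: "C (s * ?p + r) = c s r" if "r < ?p" for s r
  proof -
    have "(s * ?p + r) div ?p = s" "(s * ?p + r) mod ?p = r"
      using that by (auto simp only: div_mult_self3 mod_mult_self3 div_less mod_less)
    then show ?thesis by (simp only: C_def)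
  qed
  have "c M N = (\<Sum>i<M * N. w $ (i div N * N + i mod N))"
    unfolding c_def by (rule sum_div_mod[symmetric])
  then have "c M N = 0" using sum by simp
  then have C0: "C 0 = C ((?q - 1) * ?p) + C (?p - 1) - C (?p * ?q - 1)"
    unfolding corner using at[of 0 0] at[of 0 M] at[of N 0] at[of N M] by (simp add: c_def)
  have K: "diff_mat M \<otimes>\<^sub>m diff_mat N \<in> carrier_mat (M * N) (?p * ?q)"
    using kron_carrier[OF diff_mat_carrier diff_mat_carrier, of M N] by (simp only: mult.commute[of ?p ?q])
  let ?z = "vec (?p * ?q - 1) (\<lambda>j. C (j + 1))"
  show "?z \<in> carrier_vec (?p * ?q - 1)" by simp
  have "Kt *\<^sub>v ?z = (diff_mat M \<otimes>\<^sub>m diff_mat N) *\<^sub>v vec (?p * ?q) C"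
    unfolding Kt_def using M N C0 by (intro reduce_constraint_mult_vec[OF K]) auto
  also have "vec (?p * ?q) C = vec (?q * ?p) (\<lambda>j. c (j div ?p) (j mod ?p))"
    unfolding C_def by (simp only: mult.commute[of ?p ?q])
  also have "(diff_mat M \<otimes>\<^sub>m diff_mat N) *\<^sub>v vec (?q * ?p) (\<lambda>j. c (j div ?p) (j mod ?p)) = w"
  proof (rule eq_vecI)
    fix i assume "i < dim_vec w"
    then have "i < M * N" using w by simp
    then show "((diff_mat M \<otimes>\<^sub>m diff_mat N) *\<^sub>v vec (?q * ?p) (\<lambda>j. c (j div ?p) (j mod ?p))) $ i = w $ i"
      by (subst diff_kron_mult_vec) (auto simp: c_def sum.distrib)
  qed (use w in \<open>simp add: kron_def diff_mat_def\<close>)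
  finally show "Kt *\<^sub>v ?z = w" .
qed

section \<open>Minimality over the zero-integral splines\<close>

theorem theorem5p1:
  fixes a b c d \<alpha> :: real and g h k l u v n m :: nat
    and lam mu :: "int \<Rightarrow> real" and xs ys :: "real vec" and F :: "real mat"
  assumes "k > 0" and "l > 0"
    and "extended_knots k g a b lam" and "extended_knots l h c d mu"
    and "u \<le> k - 1" and "v \<le> l - 1"
    and "0 < \<alpha>" and "\<alpha> < 1"
    and "xs \<in> carrier_vec n" and "ys \<in> carrier_vec m" and "F \<in> carrier_mat n m"
    and "\<And>i. i < n \<Longrightarrow> xs $ i \<in> {a..b}" and "\<And>j. j < m \<Longrightarrow> ys $ j \<in> {c..d}"
  shows
    "let BB = bspline_mat mu h l ys \<otimes>\<^sub>m bspline_mat lam g k xs;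
         SS = deriv_mat mu h l v \<otimes>\<^sub>m deriv_mat lam g k u;
         MM = gram_mat mu h l v \<otimes>\<^sub>m gram_mat lam g k u;
         DD = knot_diag mu h l 0 \<otimes>\<^sub>m knot_diag lam g k 0;
         KK = diff_mat (h + l + 1) \<otimes>\<^sub>m diff_mat (g + k + 1);
         Kt = reduce_constraint (g + k + 2) (h + l + 2) KK;
         cstar = pseudoinverse
             (Kt\<^sup>T * DD\<^sup>T * ((1 - \<alpha>) \<cdot>\<^sub>m (SS\<^sup>T * MM * SS) + \<alpha> \<cdot>\<^sub>m (BB\<^sup>T * BB)) * DD * Kt)
           *\<^sub>v (\<alpha> \<cdot>\<^sub>v (Kt\<^sup>T * DD\<^sup>T * BB\<^sup>T *\<^sub>v cs F));
         s = (\<lambda>x y. ((bspline_row mu h l y \<otimes>\<^sub>m bspline_row lam g k x) * DD * Kt *\<^sub>v cstar) $ 0);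
         J = smoothing_functional a b c d u v \<alpha> xs ys F;
         \<Omega> = {a..b} \<times> {c..d};
         V = tensor_splines k g lam l h mu
     in s \<in> V
        \<and> integral \<Omega> (\<lambda>(x, y). s x y) = 0
        \<and> (\<forall>w\<in>V. integral \<Omega> (\<lambda>(x, y). w x y) = 0 \<longrightarrow> J s \<le> J w)"
proof -
  note k = assms(1) and l = assms(2) and lam = assms(3) and mu = assms(4)
  have u: "u < k" and v: "v < l" using assms(1,2,5,6) by auto
  \<comment> \<open>\<open>N\<close> and \<open>M\<close> count the univariate B-splines;
    \<open>Q\<close> counts the grid entries without the eliminated corner.\<close>
  define N M Q where "N = g + k + 1" and "M = h + l + 1" and "Q = (N + 1) * (M + 1) - 1"
  have pq: "g + k + 2 = N + 1" "h + l + 2 = M + 1" and MN: "0 < M" "0 < N" by (auto simp: N_def M_def)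
  define BB where "BB = bspline_mat mu h l ys \<otimes>\<^sub>m bspline_mat lam g k xs"
  define SS where "SS = deriv_mat mu h l v \<otimes>\<^sub>m deriv_mat lam g k u"
  define MM where "MM = gram_mat mu h l v \<otimes>\<^sub>m gram_mat lam g k u"
  define DD where "DD = knot_diag mu h l 0 \<otimes>\<^sub>m knot_diag lam g k 0"
  define Kt where "Kt = reduce_constraint (g + k + 2) (h + l + 2) (diff_mat (h + l + 1) \<otimes>\<^sub>m diff_mat (g + k + 1))"
  define G where "G = (1 - \<alpha>) \<cdot>\<^sub>m (SS\<^sup>T * MM * SS) + \<alpha> \<cdot>\<^sub>m (BB\<^sup>T * BB)"
  define R where "R = DD * Kt"
  define cstar where "cstar = pseudoinverse (Kt\<^sup>T * DD\<^sup>T * G * DD * Kt) *\<^sub>v (\<alpha> \<cdot>\<^sub>v (Kt\<^sup>T * DD\<^sup>T * BB\<^sup>T *\<^sub>v cs F))"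
  define s where "s = (\<lambda>x y. ((bspline_row mu h l y \<otimes>\<^sub>m bspline_row lam g k x) * DD * Kt *\<^sub>v cstar) $ 0)"
  define S where "S = tensor_spline lam g k mu h l"
  define E where "E = (h + l + 1 - v) * (g + k + 1 - u)"
  have xs: "dim_vec xs = n" and ys: "dim_vec ys = m" and F: "F \<in> carrier_mat n m"
    using assms(9-11) by auto
  have BB: "BB \<in> carrier_mat (m * n) (M * N)"
    unfolding BB_def M_def N_def xs[symmetric] ys[symmetric] by (intro kron_carrier bspline_mat_carrier)
  have SS: "SS \<in> carrier_mat E (M * N)"
    unfolding SS_def M_def N_def E_def using u v by (intro kron_carrier deriv_mat_carrier) auto
  have MM: "MM \<in> carrier_mat E E"
    unfolding MM_def E_def by (intro kron_carrier gram_mat_carrier)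
  have DD: "DD \<in> carrier_mat (M * N) (M * N)"
    unfolding DD_def M_def N_def using knot_diag_carrier[of _ _ _ 0] by (intro kron_carrier) auto
  have Kt_eq: "Kt = reduce_constraint (N + 1) (M + 1) (diff_mat M \<otimes>\<^sub>m diff_mat N)"
    unfolding Kt_def pq unfolding N_def M_def ..
  have Kt: "Kt \<in> carrier_mat (M * N) Q"
    unfolding Kt_eq Q_def by (simp add: reduce_constraint_def kron_def diff_mat_def mult.commute)
  have R: "R \<in> carrier_mat (M * N) Q" using DD Kt by (simp add: R_def)
  have G: "G \<in> carrier_mat (M * N) (M * N)" unfolding G_def using SS MM BB by auto
  have csF: "cs F \<in> carrier_vec (m * n)" using F by (auto simp: cs_def mult.commute)
  have MT: "MM\<^sup>T = MM"
    unfolding MM_def by (simp only: kron_transpose[OF gram_mat_carrier gram_mat_carrier] gram_mat_transpose)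
  have psd: "0 \<le> e \<bullet> (MM *\<^sub>v e)" if "e \<in> carrier_vec E" for e
    using gram_form_nonneg[OF lam mu u v] that by (simp only: MM_def E_def)
  \<comment> \<open>The matrix in the statement is the normal matrix for the composite
    parametrization \<open>R = DD * Kt\<close>; only the bracketing differs.\<close>
  have cstar_eq: "cstar = pseudoinverse (R\<^sup>T * G * R) *\<^sub>v (\<alpha> \<cdot>\<^sub>v (R\<^sup>T * BB\<^sup>T *\<^sub>v cs F))"
  proof -
    have RT: "R\<^sup>T = Kt\<^sup>T * DD\<^sup>T" unfolding R_def using DD Kt by (intro transpose_mult_dim) auto
    have "R\<^sup>T * G * R = Kt\<^sup>T * DD\<^sup>T * G * DD * Kt"
      unfolding RT unfolding R_def using DD Kt G by (simp add: mult_mat_assoc_dim)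
    then show ?thesis by (simp only: cstar_def RT)
  qed
  note lsq = regularized_least_squares[OF BB SS MM R csF MT psd assms(7), where \<beta> = "1 - \<alpha>",
      folded G_def, folded cstar_eq]
  have cstar: "cstar \<in> carrier_vec Q" using lsq(1)[of "0\<^sub>v Q"] assms(8) by simp
  have s_eq: "s = S (R *\<^sub>v cstar)"
  proof (intro ext)
    fix x y
    let ?row = "bspline_row mu h l y \<otimes>\<^sub>m bspline_row lam g k x"
    have "bspline_row mu h l y \<in> carrier_mat 1 M" "bspline_row lam g k x \<in> carrier_mat 1 N"
      by (simp_all add: bspline_row_def bspline_mat_def M_def N_def)
    from kron_carrier[OF this] have row: "?row \<in> carrier_mat 1 (M * N)" by simp
    have "?row * DD * Kt = ?row * R" unfolding R_def by (rule assoc_mult_mat[OF row DD Kt])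
    then have "?row * DD * Kt *\<^sub>v cstar = ?row *\<^sub>v (R *\<^sub>v cstar)"
      using assoc_mult_mat_vec[OF row R cstar] by (simp only:)
    moreover have "R *\<^sub>v cstar \<in> carrier_vec ((h + l + 1) * (g + k + 1))"
      using R cstar by (auto simp: M_def N_def)
    ultimately show "s x y = S (R *\<^sub>v cstar) x y"
      unfolding s_def S_def by (simp only: collocation_row_mult_vec)
  qed
  have V: "tensor_splines k g lam l h mu = S ` carrier_vec (M * N)"
    unfolding S_def M_def N_def by (rule tensor_splines_eq)
  have int: "integral ({a..b} \<times> {c..d}) (\<lambda>(x, y). S (DD *\<^sub>v w) x y) = (\<Sum>p<M * N. w $ p)"
    if "w \<in> carrier_vec (M * N)" for w
    using has_integral_tensor_spline_scaled[OF lam mu k l] that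
    unfolding S_def DD_def M_def N_def by (intro integral_unique) blast
  have R_apply: "R *\<^sub>v z = DD *\<^sub>v (Kt *\<^sub>v z)" if "z \<in> carrier_vec Q" for z
    unfolding R_def using DD Kt that by (rule assoc_mult_mat_vec)
  have "s \<in> tensor_splines k g lam l h mu"
    unfolding s_eq V using R cstar by (intro imageI) auto
  moreover have "integral ({a..b} \<times> {c..d}) (\<lambda>(x, y). s x y) = 0"
  proof -
    have "Kt *\<^sub>v cstar \<in> carrier_vec (M * N)" using Kt cstar by auto
    then show ?thesis
      unfolding s_eq R_apply[OF cstar] using int reduced_diff_kron_sum[OF MN cstar[unfolded Q_def]]
      by (simp only: Kt_eq)
  qed
  moreover have "smoothing_functional a b c d u v \<alpha> xs ys F s \<le> smoothing_functional a b c d u v \<alpha> xs ys F w"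
    if w: "w \<in> tensor_splines k g lam l h mu" and w0: "integral ({a..b} \<times> {c..d}) (\<lambda>(x, y). w x y) = 0" for w
  proof -
    obtain e where e: "e \<in> carrier_vec (M * N)" "w = S e" using w V by auto
    \<comment> \<open>The competitor is pulled back in two stages: first through the invertible
      diagonal, which turns the zero integral into a zero entry sum, then through the reduced
      differences.\<close>
    obtain y where y: "y \<in> carrier_vec (M * N)" "DD *\<^sub>v y = e"
      using knot_diag_kron_surj[OF lam mu] e(1) unfolding DD_def M_def N_def by blast
    have "(\<Sum>p<M * N. y $ p) = 0" using int[OF y(1)] w0 y(2) e(2) by simp
    then obtain z where z: "z \<in> carrier_vec Q" "Kt *\<^sub>v z = y"
      using reduced_diff_kron_surj[OF MN y(1)] unfolding Kt_eq Q_def by blast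
    have "e = R *\<^sub>v z" using R_apply[OF z(1)] z(2) y(2) by simp
    have J: "smoothing_functional a b c d u v \<alpha> xs ys F (S e') = \<alpha> * ((cs F - BB *\<^sub>v e') \<bullet> (cs F - BB *\<^sub>v e'))
        + (1 - \<alpha>) * ((SS *\<^sub>v e') \<bullet> (MM *\<^sub>v (SS *\<^sub>v e')))" if "e' \<in> carrier_vec (M * N)" for e'
      unfolding S_def BB_def SS_def MM_def using that F
      by (intro smoothing_functional_tensor_spline[OF lam mu u v]) (auto simp: xs ys M_def N_def)
    have "R *\<^sub>v cstar \<in> carrier_vec (M * N)" "R *\<^sub>v z \<in> carrier_vec (M * N)" using R cstar z by auto
    then show ?thesis
      unfolding e(2) s_eq \<open>e = R *\<^sub>v z\<close> using lsq(2)[OF _ _ z(1)] assms(8) by (simp add: J)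
  qed
  ultimately show ?thesis
    unfolding Let_def BB_def[symmetric] SS_def[symmetric] MM_def[symmetric] DD_def[symmetric]
      Kt_def[symmetric] G_def[symmetric] cstar_def[symmetric] s_def[symmetric]
    by blast
qed

end
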